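(* The operator $A$ is self-adjoint in $\mathcal H$.
   Context: $q$ is real-valued, continuous on each of $[-\pi,0)$ and $(0,\pi]$ with finite limits $q(0\mp)$; $\alpha,\beta,a_1,\dots,a_4,b_1,\dots,b_4$ are real; $\rho_{ij}=a_ib_j-a_jb_i$, with $\rho_{12}>0$, $\rho_{34}>0$. Define $\Gamma y:=-y''+qy$, $\Gamma_1(y):=a_1y'(0-)+a_2y(0-)+a_3y'(0+)+a_4y(0+)$, $\Gamma_2(y):=b_1y'(0-)+b_2y(0-)+b_3y'(0+)+b_4y(0+)$, $\Gamma_3(y):=\cos\alpha\, y(-\pi)+\sin\alpha\, y'(-\pi)$, $\Gamma_4(y):=\cos\beta\, y(\pi)+\sin\beta\, y'(\pi)$. $\mathcal H=L_2(-\pi,0)\oplus L_2(0,\pi)$ with inner product $\langle y,z\rangle_{\mathcal H}=\rho_{12}\int_{-\pi}^0 y\overline{z}\,dx+\rho_{34}\int_0^\pi y\overline{z}\,dx$. $D(A)$ is the set of all $y\in\mathcal H$ such that $y,y'$ are absolutely continuous on each of $[-\pi,0)$ and $(0,\pi]$ with finite one-sided limits $y(0\mp),y'(0\mp)$, $\Gamma y\in\mathcal H$, and $\Gamma_1(y)=\Gamma_2(y)=\Gamma_3(y)=\Gamma_4(y)=0$; $Ay:=\Gamma y$. *)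

theory Defs
  imports "HOL-Analysis.Analysis"
begin

definition AC_on :: "real set \<Rightarrow> (real \<Rightarrow> complex) \<Rightarrow> bool" where
  "AC_on S f \<longleftrightarrow> (\<forall>\<epsilon>>0. \<exists>\<delta>>0. \<forall>(n::nat) (a::nat \<Rightarrow> real) (b::nat \<Rightarrow> real).
      (\<forall>k<n. a k \<le> b k \<and> {a k..b k} \<subseteq> S) \<and>
      (\<forall>i<n. \<forall>j<n. i \<noteq> j \<longrightarrow> {a i<..<b i} \<inter> {a j<..<b j} = {}) \<and>
      (\<Sum>k<n. b k - a k) < \<delta>
      \<longrightarrow> (\<Sum>k<n. cmod (f (b k) - f (a k))) < \<epsilon>)"

text \<open>Membership in H = L2(-pi,0) + L2(0,pi) (representatives; values outside [-pi,pi] irrelevant).\<close>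
definition inH :: "(real \<Rightarrow> complex) \<Rightarrow> bool" where
  "inH f \<longleftrightarrow> set_borel_measurable lborel {-pi..pi} f \<and>
              set_integrable lborel {-pi..pi} (\<lambda>x. (cmod (f x))^2)"

definition ipH :: "real \<Rightarrow> real \<Rightarrow> (real \<Rightarrow> complex) \<Rightarrow> (real \<Rightarrow> complex) \<Rightarrow> complex" where
  "ipH r1 r2 f g = complex_of_real r1 * (LINT x:{-pi..0}|lborel. f x * cnj (g x))
                 + complex_of_real r2 * (LINT x:{0..pi}|lborel. f x * cnj (g x))"

definition normH :: "real \<Rightarrow> real \<Rightarrow> (real \<Rightarrow> complex) \<Rightarrow> real" where
  "normH r1 r2 f = sqrt (Re (ipH r1 r2 f f))"

definition eqH :: "(real \<Rightarrow> complex) \<Rightarrow> (real \<Rightarrow> complex) \<Rightarrow> bool" where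
  "eqH f g \<longleftrightarrow> (AE x in lborel. x \<in> {-pi..pi} \<longrightarrow> f x = g x)"

text \<open>A (possibly unbounded) operator in H given by its graph G (G y g means y in D(A), Ay = g).
Self-adjoint: densely defined and A = A*, where (z,w) is in the graph of A* iff
<Ay, z> = <y, w> for all y in D(A).\<close>
definition self_adjointH :: "real \<Rightarrow> real \<Rightarrow> ((real \<Rightarrow> complex) \<Rightarrow> (real \<Rightarrow> complex) \<Rightarrow> bool) \<Rightarrow> bool" where
  "self_adjointH r1 r2 G \<longleftrightarrow>
     (\<forall>y g. G y g \<longrightarrow> inH y \<and> inH g) \<and>
     (\<forall>f. inH f \<longrightarrow> (\<forall>\<epsilon>>0. \<exists>y g. G y g \<and> normH r1 r2 (\<lambda>x. f x - y x) < \<epsilon>)) \<and>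
     (\<forall>z w. inH z \<and> inH w \<longrightarrow>
        ((\<forall>y g. G y g \<longrightarrow> ipH r1 r2 g z = ipH r1 r2 y w) \<longleftrightarrow>
         (\<exists>y g. G y g \<and> eqH y z \<and> eqH g w)))"

definition piece_ok :: "real set \<Rightarrow> (real \<Rightarrow> complex) \<Rightarrow> (real \<Rightarrow> complex) \<Rightarrow> bool" where
  "piece_ok S y yd \<longleftrightarrow> AC_on S y \<and> (\<forall>x\<in>S. (y has_vector_derivative yd x) (at x within S)) \<and> AC_on S yd"

definition A_graph :: "(real \<Rightarrow> real) \<Rightarrow> real \<Rightarrow> real \<Rightarrow> real \<Rightarrow> real \<Rightarrow> real \<Rightarrow> real
   \<Rightarrow> real \<Rightarrow> real \<Rightarrow> real \<Rightarrow> real \<Rightarrow> (real \<Rightarrow> complex) \<Rightarrow> (real \<Rightarrow> complex) \<Rightarrow> bool" where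
  "A_graph q \<alpha> \<beta> a1 a2 a3 a4 b1 b2 b3 b4 y g \<longleftrightarrow>
     inH y \<and> inH g \<and>
     (\<exists>yd.
        piece_ok {-pi..<0} y yd \<and> piece_ok {0<..pi} y yd \<and>
        (\<exists>L. (y \<longlongrightarrow> L) (at_left 0)) \<and> (\<exists>L. (y \<longlongrightarrow> L) (at_right 0)) \<and>
        (\<exists>L. (yd \<longlongrightarrow> L) (at_left 0)) \<and> (\<exists>L. (yd \<longlongrightarrow> L) (at_right 0)) \<and>
        (AE x in lborel. x \<in> {-pi<..<0} \<union> {0<..<pi} \<longrightarrow>
            (yd has_vector_derivative (complex_of_real (q x) * y x - g x)) (at x)) \<and>
        of_real a1 * Lim (at_left 0) yd + of_real a2 * Lim (at_left 0) y
          + of_real a3 * Lim (at_right 0) yd + of_real a4 * Lim (at_right 0) y = 0 \<and>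
        of_real b1 * Lim (at_left 0) yd + of_real b2 * Lim (at_left 0) y
          + of_real b3 * Lim (at_right 0) yd + of_real b4 * Lim (at_right 0) y = 0 \<and>
        of_real (cos \<alpha>) * y (-pi) + of_real (sin \<alpha>) * yd (-pi) = 0 \<and>
        of_real (cos \<beta>) * y pi + of_real (sin \<beta>) * yd pi = 0)"

end

theory Submission
  imports Defs
begin

text \<open>
  The potential \<open>q\<close> is bounded and real, so multiplication by it is a bounded symmetric operator and it
  suffices to treat \<open>q = 0\<close>. Green's formula on both pieces expresses \<open>\<langle>Ay, z\<rangle> - \<langle>y, Az\<rangle>\<close> by the boundary
  data of \<open>y\<close> and \<open>z\<close>, and the weights \<open>\<rho>12\<close>, \<open>\<rho>34\<close> are exactly those for which the transmission
  conditions cancel the contributions at \<open>0-\<close> and \<open>0+\<close>. Conversely, if \<open>\<langle>Ay, z\<rangle> = \<langle>y, w\<rangle>\<close> for all \<open>y\<close> in the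
  domain, solve \<open>-u'' = w\<close> on each piece, with the two free affine constants chosen so that \<open>\<phi> = z - u\<close> is
  orthogonal to all affine functions. The solution of \<open>-v'' = \<phi>\<close> with zero data at one end then has zero
  data at the other end too, so \<open>v\<close> lies in the domain, and testing with \<open>v\<close> yields \<open>\<langle>\<phi>, \<phi>\<rangle> = 0\<close>, that is
  \<open>z = u\<close> almost everywhere. Testing with cubic splines of prescribed boundary data finally shows that
  \<open>u\<close> satisfies the boundary conditions. For the density of the domain, polynomials times a polynomial
  cutoff vanishing to second order at \<open>0, \<plusminus>\<pi>\<close> approximate polynomials, hence continuous, bounded
  measurable, and all square-integrable functions.
\<close>

text \<open>The domain is described by the epsilon-delta notion of absolute continuity and by a
  second derivative that exists only almost everywhere. Hence both directions of Lebesgue's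
  fundamental theorem are required: \<open>has_integral_AC_on\<close> for Green's formula, and
  \<open>AE_has_vector_derivative_integral\<close> to see that integrating a merely
  square-integrable \<open>w\<close> twice gives an admissible solution. The obstacle in the adjoint
  argument is that \<open>z\<close> starts out as a bare L2 function without boundary values. Affine
  functions enter because they are the kernel of y -> -y'' on each piece; orthogonality to them is
  what makes -v'' = \<phi> solvable with zero data at both ends. All boundary terms with
  \<open>v\<close> therefore vanish before anything is known about the data of \<open>u\<close>, and
  the boundary algebra is needed only afterwards. The reduction to q = 0 is the identity (A0 + Q)* =
  A0* + Q for bounded symmetric Q, carried out on graphs.\<close>

hide_const (open) Polynomial.content

section \<open>Absolutely continuous functions and the fundamental theorem of calculus\<close>

text \<open>Transports absolute continuity from families indexed by \<open>k < n\<close> to tagged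
  partial divisions, the families on which gauge integrals are tested. A bijection numbers the
  division, and disjoint interiors become the disjoint open intervals of the definition.\<close>

lemma AC_on_tagged_partial_division:
  assumes "AC_on S F" "{c..d} \<subseteq> S" "e > 0"
  obtains \<delta> where "\<delta> > 0"
    "\<And>p. \<lbrakk>p tagged_partial_division_of {c..d}; (\<Sum>(x,K)\<in>p. content K) < \<delta>\<rbrakk>
       \<Longrightarrow> (\<Sum>(x,K)\<in>p. cmod (F (Sup K) - F (Inf K))) < e"
proof -
  obtain \<delta> where "\<delta> > 0" and \<delta>: "\<And>(n::nat) a b. \<lbrakk>\<forall>k<n. a k \<le> b k \<and> {a k..b k} \<subseteq> S;
      \<forall>i<n. \<forall>j<n. i \<noteq> j \<longrightarrow> {a i<..<b i} \<inter> {a j<..<b j} = {}; (\<Sum>k<n. b k - a k) < \<delta>\<rbrakk>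
      \<Longrightarrow> (\<Sum>k<n. cmod (F (b k) - F (a k))) < e"
    using assms(1)[unfolded AC_on_def, rule_format, OF \<open>e > 0\<close>] by auto
  show thesis
  proof
    show "\<delta> > 0" by fact
    fix p assume p: "p tagged_partial_division_of {c..d}" and small: "(\<Sum>(x,K)\<in>p. content K) < \<delta>"
    have "finite p" using p by (rule tagged_partial_division_ofD)
    then obtain h where h: "bij_betw h {..<card p} p"
      using ex_bij_betw_nat_finite[of p] unfolding atLeast0LessThan by blast
    have h_in: "h k \<in> p" if "k < card p" for k
      using h that by (auto simp: bij_betw_def)
    define a b where "a = (\<lambda>k. Inf (snd (h k)))" and "b = (\<lambda>k. Sup (snd (h k)))"
    have hK: "a k \<le> b k \<and> snd (h k) = {a k..b k} \<and> {a k..b k} \<subseteq> {c..d}" if "k < card p" for k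
    proof -
      obtain x K where xK: "h k = (x, K)" by fastforce
      with h_in[OF that] have in_p: "(x, K) \<in> p" by simp
      obtain u v where uv: "K = {u..v}"
        using tagged_partial_division_ofD(4)[OF p in_p] by auto
      have "x \<in> K" "K \<subseteq> {c..d}"
        using tagged_partial_division_ofD(2,3)[OF p in_p] by auto
      with uv xK show ?thesis by (auto simp: a_def b_def)
    qed
    have "(\<Sum>k<card p. cmod (F (b k) - F (a k))) < e"
    proof (rule \<delta>)
      show "\<forall>k<card p. a k \<le> b k \<and> {a k..b k} \<subseteq> S"
        using hK assms(2) by blast
      show "\<forall>i<card p. \<forall>j<card p. i \<noteq> j \<longrightarrow> {a i<..<b i} \<inter> {a j<..<b j} = {}"
      proof (intro allI impI)
        fix i j assume ij: "i < card p" "j < card p" "i \<noteq> j"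
        have "h i \<noteq> h j" using h ij by (auto simp: bij_betw_def inj_on_def)
        then have "interior (snd (h i)) \<inter> interior (snd (h j)) = {}"
          using tagged_partial_division_ofD(5)[OF p, of "fst (h i)" "snd (h i)" "fst (h j)" "snd (h j)"]
            h_in ij by auto
        then show "{a i<..<b i} \<inter> {a j<..<b j} = {}" using hK ij by simp
      qed
      have "(\<Sum>k<card p. b k - a k) = (\<Sum>k<card p. (\<lambda>(x,K). content K) (h k))"
        using hK by (intro sum.cong) (auto simp: split_def)
      also have "\<dots> = (\<Sum>(x,K)\<in>p. content K)"
        by (rule sum.reindex_bij_betw[OF h])
      finally show "(\<Sum>k<card p. b k - a k) < \<delta>" using small by simp
    qed
    moreover have "(\<Sum>k<card p. cmod (F (b k) - F (a k))) = (\<Sum>(x,K)\<in>p. cmod (F (Sup K) - F (Inf K)))"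
      unfolding a_def b_def split_def by (rule sum.reindex_bij_betw[OF h])
    ultimately show "(\<Sum>(x,K)\<in>p. cmod (F (Sup K) - F (Inf K))) < e" by simp
  qed
qed

text \<open>As the tag lies between the endpoints, |u - x| + |v - x| = v - u. The two endpoint
  errors thus add up to \<open>e\<close> times the length, which can be summed over a
  division.\<close>

lemma straddle:
  fixes f :: "real \<Rightarrow> 'a::real_normed_vector"
  assumes "norm (f u - f x - (u - x) *\<^sub>R f') \<le> e * \<bar>u - x\<bar>"
    and "norm (f v - f x - (v - x) *\<^sub>R f') \<le> e * \<bar>v - x\<bar>" and "u \<le> x" "x \<le> v"
  shows "norm ((v - u) *\<^sub>R f' - (f v - f u)) \<le> e * (v - u)"
proof -
  have "norm ((v - u) *\<^sub>R f' - (f v - f u)) = norm (f u - f x - (u - x) *\<^sub>R f' - (f v - f x - (v - x) *\<^sub>R f'))"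
    by (auto simp: algebra_simps)
  also have "\<dots> \<le> e * \<bar>u - x\<bar> + e * \<bar>v - x\<bar>"
    using norm_triangle_ineq4[of "f u - f x - (u - x) *\<^sub>R f'" "f v - f x - (v - x) *\<^sub>R f'"] assms(1,2)
    by linarith
  also have "\<dots> = e * (v - u)" using assms(3,4) by (simp add: algebra_simps)
  finally show ?thesis .
qed

text \<open>Tags in the exceptional null set are confined to an open set of small measure, where absolute
  continuity controls the increments of \<open>F\<close>; at the other tags the derivative does.\<close>

theorem has_integral_AC_on:
  fixes F :: "real \<Rightarrow> complex"
  assumes AC: "AC_on {a..b} F" and "a \<le> b" and "negligible N"
    and deriv: "\<And>x. x \<in> {a..b} - N \<Longrightarrow> (F has_vector_derivative f x) (at x within {a..b})"
  shows "(f has_integral F b - F a) {a..b}"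
proof -
  \<comment> \<open>With value 0 on \<open>N\<close>, tags there contribute only increments of
    \<open>F\<close>; \<open>has_integral_spike\<close> returns to \<open>f\<close> at the
    end.\<close>
  define g where "g x = (if x \<in> N then 0 else f x)" for x
  have "(g has_integral F b - F a) (cbox a b)"
    unfolding has_integral
  proof (intro allI impI)
    fix e :: real assume "e > 0"
    \<comment> \<open>Half of \<open>e\<close> is reserved for the tags in \<open>N\<close>. The
      \<open>+ 1\<close> avoids division by 0 for a = b and makes e' * (b - a) < e / 2
      strict.\<close>
    define e' where "e' = e / (2 * (b - a + 1))"
    have "e' > 0" using \<open>e > 0\<close> \<open>a \<le> b\<close> by (simp add: e'_def)
    have "\<forall>x. \<exists>d>0. x \<in> {a..b} - N \<longrightarrow>
         (\<forall>y\<in>{a..b}. norm (y-x) < d \<longrightarrow> norm (F y - F x - (y-x) *\<^sub>R f x) \<le> e' * norm (y-x))"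
      using deriv[unfolded has_vector_derivative_def has_derivative_within_alt] \<open>e' > 0\<close>
      by metis
    then obtain r where r: "\<And>x. 0 < r x"
      "\<And>x y. \<lbrakk>x \<in> {a..b} - N; y \<in> {a..b}; \<bar>y-x\<bar> < r x\<rbrakk>
          \<Longrightarrow> norm (F y - F x - (y-x) *\<^sub>R f x) \<le> e' * \<bar>y-x\<bar>"
      unfolding real_norm_def by metis
    obtain \<delta> where "\<delta> > 0" and \<delta>: "\<And>p. \<lbrakk>p tagged_partial_division_of {a..b}; (\<Sum>(x,K)\<in>p. content K) < \<delta>\<rbrakk>
       \<Longrightarrow> (\<Sum>(x,K)\<in>p. cmod (F (Sup K) - F (Inf K))) < e / 2"
      using AC_on_tagged_partial_division[OF AC order_refl half_gt_zero[OF \<open>e > 0\<close>]] by blast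
    have "N \<in> sets lebesgue" "emeasure lebesgue N = 0"
      using \<open>negligible N\<close> by (auto simp: negligible_iff_null_sets)
    obtain U where U: "open U" "N \<subseteq> U" "(U - N) \<in> lmeasurable" "emeasure lebesgue (U - N) < ennreal \<delta>"
      using sets_lebesgue_outer_open[OF \<open>N \<in> sets lebesgue\<close> \<open>\<delta> > 0\<close>] by blast
    have UN: "U = (U - N) \<union> N" using U(2) by blast
    have U_meas: "U \<in> lmeasurable"
      using fmeasurable.Un[OF U(3) negligible_imp_measurable[OF \<open>negligible N\<close>]] UN by simp
    have "measure lebesgue (U - N \<union> N) \<le> measure lebesgue (U - N) + measure lebesgue N"
      by (rule measure_Un_le) (use U(3) \<open>N \<in> sets lebesgue\<close> in auto)
    also have "\<dots> < \<delta>"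
      using U(3,4) \<open>negligible N\<close> \<open>\<delta> > 0\<close>
      by (simp add: negligible_imp_measure0 emeasure_eq_measure2 ennreal_less_iff)
    finally have U_small: "measure lebesgue U < \<delta>" unfolding UN[symmetric] .
    have "\<forall>x. \<exists>s>0. x \<in> U \<longrightarrow> ball x s \<subseteq> U"
      using U(1) by (meson open_contains_ball zero_less_one)
    then obtain s where s: "\<And>x. s x > 0" "\<And>x. x \<in> U \<Longrightarrow> ball x (s x) \<subseteq> U" by metis
    define \<gamma> where "\<gamma> x = ball x (if x \<in> N then s x else r x)" for x
    show "\<exists>\<gamma>. gauge \<gamma> \<and> (\<forall>p. p tagged_division_of cbox a b \<and> \<gamma> fine p \<longrightarrow>
        norm ((\<Sum>(x,K)\<in>p. content K *\<^sub>R g x) - (F b - F a)) < e)"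
    proof (intro exI conjI allI impI)
      show "gauge \<gamma>" unfolding \<gamma>_def by (rule gauge_ball_dependent) (use r s in auto)
      fix p assume "p tagged_division_of cbox a b \<and> \<gamma> fine p"
      then have p: "p tagged_division_of {a..b}" and fine: "\<gamma> fine p" by auto
      have "finite p" using p by (rule tagged_division_of_finite)
      define P Q where "P = {t\<in>p. fst t \<in> N}" and "Q = {t\<in>p. fst t \<notin> N}"
      have PQ: "p = P \<union> Q" "P \<inter> Q = {}" "finite P" "finite Q" "P \<subseteq> p" "Q \<subseteq> p"
        using \<open>finite p\<close> by (auto simp: P_def Q_def)
      have P_part: "P tagged_partial_division_of {a..b}"
        using tagged_partial_division_subset[OF _ PQ(5)] p unfolding tagged_division_of_def by auto
      have K: "\<exists>u v. K = {u..v} \<and> u \<le> x \<and> x \<le> v \<and> {u..v} \<subseteq> {a..b}" if "(x,K) \<in> p" for x K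
        using tagged_division_ofD(2-4)[OF p that] by auto
      have K_ball: "K \<subseteq> \<gamma> x" if "(x,K) \<in> p" for x K
        using fine that unfolding fine_def by blast
      have P_sum: "(\<Sum>(x,K)\<in>P. content K) \<le> measure lebesgue U"
      proof -
        \<comment> \<open>Distinct pairs can share an interval only if its interior is empty, hence
          its content 0, so passing to the set of intervals does not change the sum.\<close>
        have inj: "(\<Sum>(x,K)\<in>P. content K) = (\<Sum>K\<in>snd ` P. content K)"
          using sum.over_tagged_division_lemma[OF tagged_partial_division_of_Union_self[OF P_part], of content]
          by (simp add: content_eq_0_interior)
        have "(\<Sum>K\<in>snd ` P. content K) = (\<Sum>K\<in>snd ` P. measure lebesgue K)"
          using K PQ(5) by (intro sum.cong) fastforce+
        also have "\<dots> = measure lebesgue (\<Union>(snd ` P))"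
          using content_division[OF partial_division_of_tagged_division[OF P_part]] by simp
        also have "\<dots> \<le> measure lebesgue U"
        proof (rule measure_mono_fmeasurable)
          show "\<Union>(snd ` P) \<subseteq> U"
          proof clarify
            fix y x K assume "(x, K) \<in> P" "y \<in> snd (x, K)"
            then have "y \<in> ball x (s x)" "x \<in> N" using K_ball[of x K] by (auto simp: P_def \<gamma>_def)
            then show "y \<in> U" using s(2) U(2) by blast
          qed
          show "\<Union>(snd ` P) \<in> sets lebesgue"
            using PQ(3,5) K by (intro sets.finite_Union) force+
        qed (use U_meas in auto)
        finally show ?thesis using inj by simp
      qed
      have P_bd: "(\<Sum>(x,K)\<in>P. cmod (F (Sup K) - F (Inf K))) < e / 2"
        using \<delta>[OF P_part] P_sum U_small by linarith
      have Q_bd: "norm (\<Sum>(x,K)\<in>Q. content K *\<^sub>R g x - (F (Sup K) - F (Inf K))) \<le> (\<Sum>(x,K)\<in>Q. e' * content K)"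
      proof (rule sum_norm_le, clarify)
        fix x K assume xK: "(x, K) \<in> Q"
        then obtain u v where uv: "K = {u..v}" "u \<le> x" "x \<le> v" "{u..v} \<subseteq> {a..b}"
          using K[of x K] PQ(6) by blast
        have "x \<notin> N" "{u..v} \<subseteq> ball x (r x)"
          using xK uv(1) K_ball[of x K] by (auto simp: Q_def \<gamma>_def)
        moreover have "u \<in> {u..v}" "v \<in> {u..v}" using uv by auto
        ultimately have "u \<in> ball x (r x)" "v \<in> ball x (r x)" by blast+
        then have "\<bar>u - x\<bar> < r x" "\<bar>v - x\<bar> < r x" by (auto simp: dist_real_def)
        moreover have "x \<in> {a..b} - N" "u \<in> {a..b}" "v \<in> {a..b}" using uv \<open>x \<notin> N\<close> by auto
        ultimately have "norm (F u - F x - (u-x) *\<^sub>R f x) \<le> e' * \<bar>u-x\<bar>" "norm (F v - F x - (v-x) *\<^sub>R f x) \<le> e' * \<bar>v-x\<bar>"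
          by (blast intro: r(2))+
        from straddle[OF this uv(2,3)] show "norm (content K *\<^sub>R g x - (F (Sup K) - F (Inf K))) \<le> e' * content K"
          using uv \<open>x \<notin> N\<close> by (simp add: g_def)
      qed
      also have "\<dots> \<le> (\<Sum>(x,K)\<in>p. e' * content K)"
        using PQ \<open>finite p\<close> \<open>e' > 0\<close> by (intro sum_mono2) (auto simp: split_def)
      also have "\<dots> = e' * (b - a)"
        using additive_content_tagged_division[of p a b] p \<open>a \<le> b\<close>
        by (simp add: split_def flip: sum_distrib_left)
      also have "\<dots> < e / 2"
        using \<open>e > 0\<close> \<open>a \<le> b\<close> by (simp add: e'_def field_simps)
      finally have Q_small: "norm (\<Sum>(x,K)\<in>Q. content K *\<^sub>R g x - (F (Sup K) - F (Inf K))) < e / 2" .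
      have P_small: "norm (\<Sum>(x,K)\<in>P. content K *\<^sub>R g x - (F (Sup K) - F (Inf K))) < e / 2"
      proof -
        have "norm (\<Sum>(x,K)\<in>P. content K *\<^sub>R g x - (F (Sup K) - F (Inf K)))
            \<le> (\<Sum>(x,K)\<in>P. cmod (F (Sup K) - F (Inf K)))"
          by (rule sum_norm_le) (auto simp: P_def g_def norm_minus_commute)
        with P_bd show ?thesis by simp
      qed
      have "F b - F a = (\<Sum>(x,K)\<in>p. F(Sup K) - F(Inf K))"
        using additive_tagged_division_1[OF \<open>a \<le> b\<close> p, of F] by simp
      then have "(\<Sum>(x,K)\<in>p. content K *\<^sub>R g x) - (F b - F a)
          = (\<Sum>(x,K)\<in>p. content K *\<^sub>R g x - (F (Sup K) - F (Inf K)))"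
        by (simp add: split_def sum_subtractf)
      also have "\<dots> = (\<Sum>(x,K)\<in>P. content K *\<^sub>R g x - (F (Sup K) - F (Inf K)))
           + (\<Sum>(x,K)\<in>Q. content K *\<^sub>R g x - (F (Sup K) - F (Inf K)))"
        using PQ by (metis (lifting) sum.union_disjoint)
      finally have "norm ((\<Sum>(x,K)\<in>p. content K *\<^sub>R g x) - (F b - F a))
          \<le> norm (\<Sum>(x,K)\<in>P. content K *\<^sub>R g x - (F (Sup K) - F (Inf K)))
           + norm (\<Sum>(x,K)\<in>Q. content K *\<^sub>R g x - (F (Sup K) - F (Inf K)))"
        using norm_triangle_ineq by simp
      then show "norm ((\<Sum>(x,K)\<in>p. content K *\<^sub>R g x) - (F b - F a)) < e"
        using P_small Q_small by linarith
    qed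
  qed
  then show ?thesis
    using has_integral_spike[OF \<open>negligible N\<close>, of "{a..b}" f g "F b - F a"] by (simp add: g_def)
qed

section \<open>Lebesgue differentiation on the line\<close>

text \<open>Henstock's lemma bounds the total length of any finite disjoint family of intervals on which the
  difference quotient at one endpoint is off by more than \<open>\<epsilon>\<close>; the Vitali covering theorem
  turns this into a bound on the measure of the set of all such endpoints.\<close>

lemma negligible_bad_difference_quotients:
  fixes f :: "real \<Rightarrow> 'a::euclidean_space"
  assumes f: "f integrable_on {a..b}" and "\<epsilon> > 0"
  defines "F \<equiv> \<lambda>x. integral {a..x} f"
  shows "negligible {x\<in>{a<..<b}. \<forall>d>0. \<exists>y\<in>{a<..<b}. y \<noteq> x \<and> \<bar>y - x\<bar> < d \<and>
            norm (F y - F x - (y - x) *\<^sub>R f x) > \<epsilon> * \<bar>y - x\<bar>}" (is "negligible ?S")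
  unfolding negligible_outer_le
proof (intro allI impI)
  fix e :: real assume "e > 0"
  \<comment> \<open>On a bad interval the Henstock error exceeds \<epsilon> times the length, so a
    total error below \<open>e * \<epsilon>\<close> forces a total length of at most
    \<open>e\<close>.\<close>
  obtain \<gamma> where "gauge \<gamma>" and \<gamma>: "\<And>p. \<lbrakk>p tagged_partial_division_of (cbox a b); \<gamma> fine p\<rbrakk> \<Longrightarrow>
             sum (\<lambda>(x,k). norm(content k *\<^sub>R f x - integral k f)) p < e * \<epsilon>"
    using Henstock_lemma[of f a b "e * \<epsilon>"] f \<open>e > 0\<close> \<open>\<epsilon> > 0\<close> by auto
  \<comment> \<open>A pair is read as (tag, other endpoint). The interval between them, in either
    order, is also a closed ball about its midpoint, the shape required by the Vitali
    theorem.\<close>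
  define I where "I = (\<lambda>(x::real,y). {min x y..max x y})"
  define c r where "c = (\<lambda>(x::real,y). (x + y) / 2)" and "r = (\<lambda>(x::real,y). \<bar>y - x\<bar> / 2)"
  have I_cball: "cball (c i) (r i) = I i" for i
    by (cases i) (auto simp: I_def c_def r_def cball_eq_atLeastAtMost min_def max_def field_simps)
  define T where "T = {(x,y). x \<in> {a<..<b} \<and> y \<in> {a<..<b} \<and> y \<noteq> x \<and> I (x,y) \<subseteq> \<gamma> x \<and>
            norm (F y - F x - (y - x) *\<^sub>R f x) > \<epsilon> * \<bar>y - x\<bar>}"
  have F_diff: "norm (F y - F x - (y - x) *\<^sub>R f x) = norm (content (I (x,y)) *\<^sub>R f x - integral (I (x,y)) f)"
    if "x \<in> {a<..<b}" "y \<in> {a<..<b}" for x y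
  proof (cases "x \<le> y")
    case True
    have "integral {a..x} f + integral {x..y} f = integral {a..y} f"
      using f that True by (intro Henstock_Kurzweil_Integration.integral_combine) (auto intro: integrable_on_subinterval)
    then have "F y - F x = integral {x..y} f" by (simp add: F_def algebra_simps)
    then show ?thesis using True by (simp add: I_def norm_minus_commute)
  next
    case False
    have "integral {a..y} f + integral {y..x} f = integral {a..x} f"
      using f that False by (intro Henstock_Kurzweil_Integration.integral_combine) (auto intro: integrable_on_subinterval)
    then have *: "F y - F x = - integral {y..x} f" by (simp add: F_def algebra_simps)
    have "F y - F x - (y - x) *\<^sub>R f x = (x - y) *\<^sub>R f x - integral {y..x} f"
      unfolding * by (simp add: algebra_simps)
    then show ?thesis using False by (simp add: I_def min_def max_def)
  qed
  have close: "\<exists>y\<in>{a<..<b}. y \<noteq> x \<and> \<bar>y - x\<bar> < min s d \<and> norm (F y - F x - (y - x) *\<^sub>R f x) > \<epsilon> * \<bar>y - x\<bar>"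
    if "x \<in> ?S" "d > 0" "s > 0" for x d s
    using that(2,3) conjunct2[OF that(1)[unfolded mem_Collect_eq], rule_format, of "min s d"] by simp
  have "\<exists>i. i \<in> T \<and> x \<in> cball (c i) (r i) \<and> r i < d" if xS: "x \<in> ?S" "d > 0" for x d
  proof -
    have "open (\<gamma> x)" "x \<in> \<gamma> x" using \<open>gauge \<gamma>\<close> by (auto simp: gauge_def)
    then obtain s where "s > 0" "ball x s \<subseteq> \<gamma> x" by (meson open_contains_ball)
    obtain y where y: "y \<in> {a<..<b}" "y \<noteq> x" "\<bar>y - x\<bar> < min s d"
        "norm (F y - F x - (y - x) *\<^sub>R f x) > \<epsilon> * \<bar>y - x\<bar>"
      using close[OF xS, of s] \<open>s > 0\<close> by auto
    have "I (x,y) \<subseteq> ball x s" using y(3) by (auto simp: I_def dist_real_def)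
    then have "(x,y) \<in> T" using that y \<open>ball x s \<subseteq> \<gamma> x\<close> by (auto simp: T_def)
    moreover have "x \<in> cball (c (x,y)) (r (x,y))" unfolding I_cball by (simp add: I_def)
    moreover have "r (x,y) < d" using y(3) xS(2) unfolding r_def by simp
    ultimately show ?thesis by blast
  qed
  moreover have "0 < r i" if "i \<in> T" for i using that by (auto simp: T_def r_def)
  ultimately obtain C where C: "countable C" "C \<subseteq> T"
     "pairwise (\<lambda>i j. disjnt (cball (c i) (r i)) (cball (c j) (r j))) C"
     "negligible (?S - (\<Union>i \<in> C. cball (c i) (r i)))"
    using Vitali_covering_theorem_cballs[of T r ?S c] by (smt (verit))
  \<comment> \<open>Only finite subfamilies form partial divisions; the uniform bound passes to the
    countable union afterwards.\<close>
  have fin: "measure lebesgue (\<Union>i\<in>D. I i) \<le> e" if "D \<subseteq> C" "finite D" for D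
  proof -
    define p where "p = (\<lambda>i. (fst i, I i)) ` D"
    have I_ne: "fst i \<in> I i" for i by (cases i) (simp add: I_def)
    have disj: "I i \<inter> I j = {}" if "i \<in> D" "j \<in> D" "i \<noteq> j" for i j
      using C(3) that \<open>D \<subseteq> C\<close> unfolding pairwise_def I_cball disjnt_def by blast
    have inj: "inj_on (\<lambda>i. (fst i, I i)) D"
      using disj I_ne unfolding inj_on_def by blast
    have part: "p tagged_partial_division_of (cbox a b)"
      unfolding tagged_partial_division_of_def
    proof (intro conjI allI impI)
      show "finite p" using that by (simp add: p_def)
      fix x K assume "(x, K) \<in> p"
      then obtain i where i: "i \<in> D" "x = fst i" "K = I i" by (auto simp: p_def)
      show "x \<in> K" using I_ne i by simp
      show "K \<subseteq> cbox a b" using i C(2) \<open>D \<subseteq> C\<close> by (cases i) (auto simp: T_def I_def)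
      show "\<exists>a b. K = cbox a b" using i by (cases i) (auto simp: I_def)
    next
      fix x K x' K' assume "(x, K) \<in> p \<and> (x', K') \<in> p \<and> (x, K) \<noteq> (x', K')"
      then obtain i j where "i \<in> D" "j \<in> D" "i \<noteq> j" "K = I i" "K' = I j" by (auto simp: p_def)
      then have "K \<inter> K' = {}" using disj by blast
      then show "interior K \<inter> interior K' = {}" using interior_subset by blast
    qed
    have I_sub: "I i \<subseteq> \<gamma> (fst i)" if "i \<in> T" for i using that by (auto simp: T_def)
    then have "\<gamma> fine p" using C(2) \<open>D \<subseteq> C\<close> by (fastforce simp: p_def fine_def)
    with part have "(\<Sum>(x,k)\<in>p. norm (content k *\<^sub>R f x - integral k f)) < e * \<epsilon>" by (rule \<gamma>)
    then have bd: "(\<Sum>i\<in>D. norm (content (I i) *\<^sub>R f (fst i) - integral (I i) f)) < e * \<epsilon>"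
      by (simp add: p_def sum.reindex[OF inj])
    have "measure lebesgue (\<Union>i\<in>D. I i) \<le> (\<Sum>i\<in>D. measure lebesgue (I i))"
      by (rule measure_UNION_le) (use that in \<open>auto simp: I_def split_def\<close>)
    then have "\<epsilon> * measure lebesgue (\<Union>i\<in>D. I i) \<le> (\<Sum>i\<in>D. \<epsilon> * measure lebesgue (I i))"
      using \<open>\<epsilon> > 0\<close> by (simp flip: sum_distrib_left)
    also have "\<dots> \<le> (\<Sum>i\<in>D. norm (content (I i) *\<^sub>R f (fst i) - integral (I i) f))"
    proof (rule sum_mono)
      fix i assume "i \<in> D"
      then have "i \<in> T" using C(2) \<open>D \<subseteq> C\<close> by blast
      obtain x y where i: "i = (x, y)" by fastforce
      have "measure lebesgue (I i) = \<bar>y - x\<bar>" by (auto simp: I_def i)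
      then show "\<epsilon> * measure lebesgue (I i) \<le> norm (content (I i) *\<^sub>R f (fst i) - integral (I i) f)"
        using \<open>i \<in> T\<close> F_diff[of x y] by (auto simp: T_def i)
    qed
    finally have "\<epsilon> * measure lebesgue (\<Union>i\<in>D. I i) \<le> \<epsilon> * e" using bd by (simp add: mult.commute)
    then show ?thesis using \<open>\<epsilon> > 0\<close> by simp
  qed
  have I_meas: "I i \<in> lmeasurable" for i by (cases i) (simp add: I_def)
  have U: "(\<Union>i\<in>C. I i) \<in> lmeasurable" "measure lebesgue (\<Union>i\<in>C. I i) \<le> e"
    using fmeasurable_UN_bound[OF C(1) I_meas fin] measure_UN_bound[OF C(1) I_meas fin] by auto
  have neg: "negligible (?S - (\<Union>i \<in> C. I i))" using C(4) unfolding I_cball .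
  show "\<exists>T. ?S \<subseteq> T \<and> T \<in> lmeasurable \<and> measure lebesgue T \<le> e"
  proof (intro exI conjI)
    show "?S \<subseteq> (?S - (\<Union>i \<in> C. I i)) \<union> (\<Union>i\<in>C. I i)" by blast
    show "(?S - (\<Union>i \<in> C. I i)) \<union> (\<Union>i\<in>C. I i) \<in> lmeasurable"
      by (rule fmeasurable.Un[OF negligible_imp_measurable[OF neg] U(1)])
    have "measure lebesgue ((?S - (\<Union>i \<in> C. I i)) \<union> (\<Union>i\<in>C. I i))
       \<le> measure lebesgue (?S - (\<Union>i \<in> C. I i)) + measure lebesgue (\<Union>i\<in>C. I i)"
      by (rule measure_Un_le[OF fmeasurableD[OF negligible_imp_measurable[OF neg]] fmeasurableD[OF U(1)]])
    with U(2) neg show "measure lebesgue ((?S - (\<Union>i \<in> C. I i)) \<union> (\<Union>i\<in>C. I i)) \<le> e"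
      by (simp add: negligible_imp_measure0)
  qed
qed

text \<open>If f x is not the derivative at x, then for some n the difference quotients miss f x by
  more than 1 / (n + 1) arbitrarily close to x; a countable union of null sets is null.\<close>

theorem AE_has_vector_derivative_integral:
  fixes f :: "real \<Rightarrow> 'a::euclidean_space"
  assumes f: "f integrable_on {a..b}"
  shows "AE x in lborel. x \<in> {a<..<b} \<longrightarrow> ((\<lambda>x. integral {a..x} f) has_vector_derivative f x) (at x)"
proof -
  define F where "F = (\<lambda>x. integral {a..x} f)"
  define S where "S \<epsilon> = {x\<in>{a<..<b}. \<forall>d>0. \<exists>y\<in>{a<..<b}. y \<noteq> x \<and> \<bar>y - x\<bar> < d \<and>
            norm (F y - F x - (y - x) *\<^sub>R f x) > \<epsilon> * \<bar>y - x\<bar>}" for \<epsilon>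
  have neg: "negligible (\<Union>n. S (inverse (real (Suc n))))"
    unfolding S_def F_def
    by (rule negligible_Union_nat, rule negligible_bad_difference_quotients[OF f]) simp
  have "(F has_vector_derivative f x) (at x)" if x: "x \<in> {a<..<b}" "x \<notin> (\<Union>n. S (inverse (real (Suc n))))" for x
    unfolding has_vector_derivative_def has_derivative_at_alt
  proof (intro conjI allI impI)
    show "bounded_linear (\<lambda>h. h *\<^sub>R f x)" by (rule bounded_linear_scaleR_left)
    fix e :: real assume "e > 0"
    then obtain n where n: "inverse (real (Suc n)) < e" using reals_Archimedean by blast
    obtain d where "d > 0" and d: "\<And>y. y \<in> {a<..<b} \<Longrightarrow> y \<noteq> x \<Longrightarrow> \<bar>y - x\<bar> < d \<Longrightarrow>
        norm (F y - F x - (y - x) *\<^sub>R f x) \<le> inverse (real (Suc n)) * \<bar>y - x\<bar>"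
      using x unfolding S_def UN_iff mem_Collect_eq by (metis UNIV_I not_less)
    show "\<exists>d>0. \<forall>y. norm (y - x) < d \<longrightarrow> norm (F y - F x - (y - x) *\<^sub>R f x) \<le> e * norm (y - x)"
    proof (intro exI conjI allI impI)
      \<comment> \<open>Distances below x - a and b - x keep \<open>y\<close> in the open interval,
        where the estimate behind \<open>S\<close> is available.\<close>
      show "Min {d, x - a, b - x} > 0" using x \<open>d > 0\<close> by simp
      fix y assume y: "norm (y - x) < Min {d, x - a, b - x}"
      show "norm (F y - F x - (y - x) *\<^sub>R f x) \<le> e * norm (y - x)"
      proof (cases "y = x")
        case False
        have "norm (F y - F x - (y - x) *\<^sub>R f x) \<le> inverse (real (Suc n)) * \<bar>y - x\<bar>"
          using y by (intro d False) auto
        also have "\<dots> \<le> e * \<bar>y - x\<bar>" using n by (intro mult_right_mono) auto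
        finally show ?thesis by simp
      qed simp
    qed
  qed
  moreover have "AE x in lebesgue. x \<notin> (\<Union>n. S (inverse (real (Suc n))))"
    using neg by (simp only: negligible_iff_null_sets AE_not_in)
  ultimately have "AE x in lebesgue. x \<in> {a<..<b} \<longrightarrow> (F has_vector_derivative f x) (at x)"
    by (auto elim: eventually_mono)
  then show ?thesis by (simp add: F_def AE_completion_iff)
qed

section \<open>Closure properties of absolute continuity, from bounds on single increments\<close>

lemma AC_on_dominated:
  assumes f: "AC_on S f" and g: "AC_on S g" and "T \<subseteq> S" and "C \<ge> 0"
    and le: "\<And>x y. x \<in> T \<Longrightarrow> y \<in> T \<Longrightarrow>
      cmod (h y - h x) \<le> C * (cmod (f y - f x) + cmod (g y - g x))"
  shows "AC_on T h"
  unfolding AC_on_def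
proof (intro allI impI)
  fix e :: real assume "e > 0"
  \<comment> \<open>The factor 2 accounts for the two sums, and \<open>C + 1\<close> in place of
    \<open>C\<close> makes the division legitimate for C = 0.\<close>
  define e' where "e' = e / (2 * (C + 1))"
  have "e' > 0" using \<open>e > 0\<close> \<open>C \<ge> 0\<close> by (simp add: e'_def)
  obtain d1 where d1: "d1 > 0" "\<And>(n::nat) a b. (\<forall>k<n. a k \<le> b k \<and> {a k..b k} \<subseteq> S) \<and>
      (\<forall>i<n. \<forall>j<n. i \<noteq> j \<longrightarrow> {a i<..<b i} \<inter> {a j<..<b j} = {}) \<and>
      (\<Sum>k<n. b k - a k) < d1 \<Longrightarrow> (\<Sum>k<n. cmod (f (b k) - f (a k))) < e'"
    using f[unfolded AC_on_def, rule_format, OF \<open>e' > 0\<close>] by blast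
  obtain d2 where d2: "d2 > 0" "\<And>(n::nat) a b. (\<forall>k<n. a k \<le> b k \<and> {a k..b k} \<subseteq> S) \<and>
      (\<forall>i<n. \<forall>j<n. i \<noteq> j \<longrightarrow> {a i<..<b i} \<inter> {a j<..<b j} = {}) \<and>
      (\<Sum>k<n. b k - a k) < d2 \<Longrightarrow> (\<Sum>k<n. cmod (g (b k) - g (a k))) < e'"
    using g[unfolded AC_on_def, rule_format, OF \<open>e' > 0\<close>] by blast
  show "\<exists>\<delta>>0. \<forall>(n::nat) a b. (\<forall>k<n. a k \<le> b k \<and> {a k..b k} \<subseteq> T) \<and>
      (\<forall>i<n. \<forall>j<n. i \<noteq> j \<longrightarrow> {a i<..<b i} \<inter> {a j<..<b j} = {}) \<and>
      (\<Sum>k<n. b k - a k) < \<delta> \<longrightarrow> (\<Sum>k<n. cmod (h (b k) - h (a k))) < e"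
  proof (intro exI conjI allI impI)
    show "min d1 d2 > 0" using d1 d2 by simp
    fix n :: nat and a b :: "nat \<Rightarrow> real"
    assume H: "(\<forall>k<n. a k \<le> b k \<and> {a k..b k} \<subseteq> T) \<and>
      (\<forall>i<n. \<forall>j<n. i \<noteq> j \<longrightarrow> {a i<..<b i} \<inter> {a j<..<b j} = {}) \<and>
      (\<Sum>k<n. b k - a k) < min d1 d2"
    then have "\<forall>k<n. a k \<le> b k \<and> {a k..b k} \<subseteq> S" using \<open>T \<subseteq> S\<close> by blast
    then have fg: "(\<Sum>k<n. cmod (f (b k) - f (a k))) < e'" "(\<Sum>k<n. cmod (g (b k) - g (a k))) < e'"
      using H d1(2)[of n a b] d2(2)[of n a b] by auto
    have "(\<Sum>k<n. cmod (h (b k) - h (a k))) \<le> (\<Sum>k<n. C * (cmod (f (b k) - f (a k)) + cmod (g (b k) - g (a k))))"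
    proof (intro sum_mono le)
      fix k assume "k \<in> {..<n}"
      then have "a k \<le> b k" "{a k..b k} \<subseteq> T" using H by auto
      then show "a k \<in> T" "b k \<in> T" by auto
    qed
    also have "\<dots> = C * ((\<Sum>k<n. cmod (f (b k) - f (a k))) + (\<Sum>k<n. cmod (g (b k) - g (a k))))"
      by (simp only: sum.distrib sum_distrib_left distrib_left)
    also have "\<dots> \<le> C * (e' + e')"
      using fg \<open>C \<ge> 0\<close> by (intro mult_left_mono add_mono) auto
    also have "\<dots> < e"
    proof -
      have "2 * (C + 1) * e' = e" using \<open>C \<ge> 0\<close> by (simp add: e'_def)
      with \<open>e' > 0\<close> show ?thesis by (simp add: algebra_simps)
    qed
    finally show "(\<Sum>k<n. cmod (h (b k) - h (a k))) < e" .
  qed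
qed

lemma AC_on_subset: "AC_on S f \<Longrightarrow> T \<subseteq> S \<Longrightarrow> AC_on T f"
  by (rule AC_on_dominated[of S f f T 1]) simp_all

text \<open>The case n = 1 of absolute continuity is uniform continuity, once the segment between
  two points of S is known to lie in S.\<close>

lemma AC_on_continuous_on:
  assumes "AC_on S f" "is_interval S"
  shows "continuous_on S f"
  unfolding continuous_on_iff
proof (intro ballI allI impI)
  fix x and e :: real assume "x \<in> S" "e > 0"
  obtain d where d: "d > 0" "\<And>(n::nat) a b. (\<forall>k<n. a k \<le> b k \<and> {a k..b k} \<subseteq> S) \<and>
      (\<forall>i<n. \<forall>j<n. i \<noteq> j \<longrightarrow> {a i<..<b i} \<inter> {a j<..<b j} = {}) \<and>
      (\<Sum>k<n. b k - a k) < d \<Longrightarrow> (\<Sum>k<n. cmod (f (b k) - f (a k))) < e"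
    using assms(1)[unfolded AC_on_def, rule_format, OF \<open>e > 0\<close>] by blast
  show "\<exists>d>0. \<forall>x'\<in>S. dist x' x < d \<longrightarrow> dist (f x') (f x) < e"
  proof (intro exI conjI ballI impI)
    show "d > 0" by fact
    fix x' assume x': "x' \<in> S" "dist x' x < d"
    have "{min x x'..max x x'} \<subseteq> S"
      using mem_is_interval_1_I[OF \<open>is_interval S\<close> \<open>x \<in> S\<close> x'(1)]
        mem_is_interval_1_I[OF \<open>is_interval S\<close> x'(1) \<open>x \<in> S\<close>]
      by (cases "x \<le> x'") auto
    then have "(\<Sum>k<(1::nat). cmod (f (max x x') - f (min x x'))) < e"
      using x'(2) by (intro d(2)) (auto simp: dist_real_def)
    then show "dist (f x') (f x) < e"
      by (auto simp: dist_norm min_def max_def norm_minus_commute split: if_splits)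
  qed
qed

lemma AC_on_mult:
  assumes f: "AC_on {c..d} f" and g: "AC_on {c..d} g"
  shows "AC_on {c..d} (\<lambda>x. f x * g x)"
proof -
  have "\<exists>B>0. \<forall>x\<in>{c..d}. cmod (h x) \<le> B" if "AC_on {c..d} h" for h
    using compact_imp_bounded[OF compact_continuous_image[OF AC_on_continuous_on[OF that]]]
    by (auto simp: bounded_pos)
  then obtain A B where A: "A > 0" "\<And>x. x \<in> {c..d} \<Longrightarrow> cmod (f x) \<le> A"
    and B: "B > 0" "\<And>x. x \<in> {c..d} \<Longrightarrow> cmod (g x) \<le> B"
    using f g by metis
  show ?thesis
  proof (rule AC_on_dominated[OF f g order_refl, of "A + B"])
    show "A + B \<ge> 0" using A B by simp
    fix x y assume xy: "x \<in> {c..d}" "y \<in> {c..d}"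
    have "f y * g y - f x * g x = f y * (g y - g x) + (f y - f x) * g x" by (simp add: algebra_simps)
    then have "cmod (f y * g y - f x * g x) \<le> cmod (f y) * cmod (g y - g x) + cmod (f y - f x) * cmod (g x)"
      by (metis norm_mult norm_triangle_ineq)
    also have "\<dots> \<le> (A + B) * cmod (g y - g x) + cmod (f y - f x) * (A + B)"
      using A(2)[OF xy(2)] B(2)[OF xy(1)] A(1) B(1) by (intro add_mono mult_right_mono mult_left_mono) auto
    finally show "cmod (f y * g y - f x * g x) \<le> (A + B) * (cmod (f y - f x) + cmod (g y - g x))"
      by (simp add: algebra_simps)
  qed
qed

lemma AC_on_diff:
  assumes "AC_on S f" "AC_on S g"
  shows "AC_on S (\<lambda>x. f x - g x)"
proof (rule AC_on_dominated[OF assms order_refl, of 1])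
  fix x y
  have "f y - g y - (f x - g x) = (f y - f x) - (g y - g x)" by simp
  then show "cmod (f y - g y - (f x - g x)) \<le> 1 * (cmod (f y - f x) + cmod (g y - g x))"
    by (metis norm_triangle_ineq4 mult_1)
qed simp

lemma AC_on_minus: "AC_on S f \<Longrightarrow> AC_on S (\<lambda>x. - f x)"
  by (rule AC_on_dominated[of S f f S 1]) (simp_all add: norm_minus_commute)

lemma AC_on_cnj: "AC_on S f \<Longrightarrow> AC_on S (\<lambda>x. cnj (f x))"
  by (rule AC_on_dominated[of S f f S 1]) (simp_all flip: complex_cnj_diff)

lemma AC_on_cong:
  assumes "AC_on S f" "\<And>x. x \<in> S \<Longrightarrow> g x = f x"
  shows "AC_on S g"
  by (rule AC_on_dominated[OF assms(1) assms(1) order_refl, of 1]) (simp_all add: assms(2))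

lemma AC_on_add_const: "AC_on S f \<Longrightarrow> AC_on S (\<lambda>x. c + f x)"
  by (rule AC_on_dominated[of S f f S 1]) simp_all

section \<open>Absolute continuity of indefinite integrals\<close>

lemma sum_integral_disjoint_le:
  fixes g :: "real \<Rightarrow> real" and u v :: "nat \<Rightarrow> real"
  assumes g: "g integrable_on {a..b}" "\<And>x. x \<in> {a..b} \<Longrightarrow> 0 \<le> g x"
    and sub: "\<And>k. k < n \<Longrightarrow> {u k..v k} \<subseteq> {a..b}"
    and disj: "\<And>i j. i < n \<Longrightarrow> j < n \<Longrightarrow> i \<noteq> j \<Longrightarrow> {u i<..<v i} \<inter> {u j<..<v j} = {}"
  shows "(\<Sum>k<n. integral {u k..v k} g) \<le> integral {a..b} g"
proof -
  \<comment> \<open>The closed intervals may share endpoints. Cutting \<open>g\<close> off to the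
    open ones keeps the integrals and leaves at most one non-zero summand at each point.\<close>
  define h where "h k x = (if x \<in> {u k<..<v k} then g x else 0)" for k :: nat and x
  have sub': "{u k<..<v k} \<subseteq> {a..b}" if "k < n" for k
    using sub[OF that] greaterThanLessThan_subseteq_atLeastAtMost_iff by fastforce
  have h: "(h k has_integral integral {u k..v k} g) {a..b}" if "k < n" for k
  proof -
    have "(g has_integral integral {u k..v k} g) {u k..v k}"
      using integrable_on_subinterval[OF g(1) sub[OF that]] by (rule integrable_integral)
    then have "(g has_integral integral {u k..v k} g) {u k<..<v k}"
      using has_integral_open_interval[of g _ "u k" "v k"] by (simp add: box_real)
    then show ?thesis
      unfolding h_def using has_integral_restrict[OF sub'[OF that]] by blast
  qed
  have "((\<lambda>x. \<Sum>k<n. h k x) has_integral (\<Sum>k<n. integral {u k..v k} g)) {a..b}"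
    using h by (intro has_integral_sum) auto
  moreover have "(g has_integral integral {a..b} g) {a..b}" using g(1) by (rule integrable_integral)
  moreover have "(\<Sum>k<n. h k x) \<le> g x" if x: "x \<in> {a..b}" for x
  proof (cases "\<exists>k<n. x \<in> {u k<..<v k}")
    case True
    then obtain k where k: "k < n" "x \<in> {u k<..<v k}" by blast
    have "(\<Sum>i<n. h i x) = (\<Sum>i<n. if i = k then g x else 0)"
    proof (rule sum.cong)
      fix i assume "i \<in> {..<n}"
      then have "x \<notin> {u i<..<v i}" if "i \<noteq> k" using disj[OF _ k(1) that] k(2) by blast
      then show "h i x = (if i = k then g x else 0)" using k(2) by (auto simp: h_def)
    qed simp
    with k show ?thesis by simp
  next
    case False
    then have "(\<Sum>k<n. h k x) = 0" by (intro sum.neutral) (auto simp: h_def)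
    with g(2)[OF x] show ?thesis by simp
  qed
  ultimately show ?thesis by (rule has_integral_le)
qed

text \<open>The weighted inequality \<open>|w| \<le> (t |w|\<^sup>2 + 1/t) / 2\<close> with small \<open>t\<close> replaces the absolute
  continuity of the integral of \<open>|w|\<close>.\<close>

lemma AC_on_integral:
  fixes w :: "real \<Rightarrow> complex"
  assumes w: "w absolutely_integrable_on {a..b}" and w2: "(\<lambda>x. (cmod (w x))\<^sup>2) integrable_on {a..b}"
  shows "AC_on {a..b} (\<lambda>x. integral {a..x} w)"
  unfolding AC_on_def
proof (intro allI impI)
  fix e :: real assume "e > 0"
  define M where "M = integral {a..b} (\<lambda>x. (cmod (w x))\<^sup>2)"
  \<comment> \<open>Since t * M <= e, the terms with |w|^2 contribute at most \<open>e / 2\<close>;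
    the bound \<open>t * e\<close> on the total length leaves less than \<open>e / 2\<close> for the
    rest. The \<open>+ 1\<close> covers M = 0.\<close>
  define t where "t = e / (M + 1)"
  have "M \<ge> 0" unfolding M_def by (rule integral_nonneg[OF w2]) simp
  then have "t > 0" using \<open>e > 0\<close> by (simp add: t_def)
  have wi: "w integrable_on {a..b}" using w by (rule set_lebesgue_integral_eq_integral)
  have ni: "(\<lambda>x. cmod (w x)) integrable_on {a..b}"
    using w absolutely_integrable_on_def by blast
  have tM: "t * M \<le> e" using \<open>M \<ge> 0\<close> \<open>e > 0\<close> by (simp add: t_def field_simps)
  show "\<exists>\<delta>>0. \<forall>(n::nat) u v. (\<forall>k<n. u k \<le> v k \<and> {u k..v k} \<subseteq> {a..b}) \<and>
      (\<forall>i<n. \<forall>j<n. i \<noteq> j \<longrightarrow> {u i<..<v i} \<inter> {u j<..<v j} = {}) \<and>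
      (\<Sum>k<n. v k - u k) < \<delta> \<longrightarrow> (\<Sum>k<n. cmod (integral {a..v k} w - integral {a..u k} w)) < e"
  proof (intro exI conjI allI impI)
    show "t * e > 0" using \<open>t > 0\<close> \<open>e > 0\<close> by simp
    fix n :: nat and u v :: "nat \<Rightarrow> real"
    assume "(\<forall>k<n. u k \<le> v k \<and> {u k..v k} \<subseteq> {a..b}) \<and>
      (\<forall>i<n. \<forall>j<n. i \<noteq> j \<longrightarrow> {u i<..<v i} \<inter> {u j<..<v j} = {}) \<and>
      (\<Sum>k<n. v k - u k) < t * e"
    then have uv: "\<And>k. k < n \<Longrightarrow> u k \<le> v k" and sub: "\<And>k. k < n \<Longrightarrow> {u k..v k} \<subseteq> {a..b}"
      and disj: "\<And>i j. i < n \<Longrightarrow> j < n \<Longrightarrow> i \<noteq> j \<Longrightarrow> {u i<..<v i} \<inter> {u j<..<v j} = {}"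
      and small: "(\<Sum>k<n. v k - u k) < t * e" by blast+
    have "cmod (integral {a..v k} w - integral {a..u k} w)
        \<le> t / 2 * integral {u k..v k} (\<lambda>x. (cmod (w x))\<^sup>2) + 1 / (2 * t) * (v k - u k)" if k: "k < n" for k
    proof -
      have ab: "a \<le> u k" "v k \<le> b" "u k \<le> v k" using uv[OF k] sub[OF k] by auto
      have comb: "integral {a..u k} w + integral {u k..v k} w = integral {a..v k} w"
        using ab by (intro Henstock_Kurzweil_Integration.integral_combine integrable_on_subinterval[OF wi]) auto
      have "cmod (integral {a..v k} w - integral {a..u k} w) = cmod (integral {u k..v k} w)"
        unfolding comb[symmetric] by simp
      also have "\<dots> \<le> t / 2 * integral {u k..v k} (\<lambda>x. (cmod (w x))\<^sup>2) + 1 / (2 * t) * (v k - u k)"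
      proof -
        have "w integrable_on {u k..v k}" by (rule integrable_on_subinterval[OF wi sub[OF k]])
        moreover have rhs: "((\<lambda>x. t / 2 * (cmod (w x))\<^sup>2 + 1 / (2 * t)) has_integral
            t / 2 * integral {u k..v k} (\<lambda>x. (cmod (w x))\<^sup>2) + 1 / (2 * t) * (v k - u k)) {u k..v k}"
          using has_integral_const_real[of "1 / (2 * t)" "u k" "v k"] ab
            integrable_integral[OF integrable_on_subinterval[OF w2 sub[OF k]]]
          by (intro has_integral_add has_integral_mult_right) (auto simp: mult.commute)
        moreover have "cmod (w x) \<le> t / 2 * (cmod (w x))\<^sup>2 + 1 / (2 * t)" for x
        proof -
          \<comment> \<open>Expanding this square and dividing by 2 t gives the weighted
            inequality.\<close>
          have "0 \<le> (t * cmod (w x) - 1)\<^sup>2" by simp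
          then show ?thesis
            using \<open>t > 0\<close> by (simp add: field_simps power2_eq_square)
        qed
        ultimately have "cmod (integral {u k..v k} w) \<le> integral {u k..v k} (\<lambda>x. t / 2 * (cmod (w x))\<^sup>2 + 1 / (2 * t))"
          by (intro integral_norm_bound_integral) (auto intro: has_integral_integrable)
        with integral_unique[OF rhs] show ?thesis by simp
      qed
      finally show ?thesis .
    qed
    then have "(\<Sum>k<n. cmod (integral {a..v k} w - integral {a..u k} w))
       \<le> (\<Sum>k<n. t / 2 * integral {u k..v k} (\<lambda>x. (cmod (w x))\<^sup>2) + 1 / (2 * t) * (v k - u k))"
      by (intro sum_mono) auto
    also have "\<dots> = t / 2 * (\<Sum>k<n. integral {u k..v k} (\<lambda>x. (cmod (w x))\<^sup>2)) + 1 / (2 * t) * (\<Sum>k<n. v k - u k)"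
      by (simp add: sum.distrib sum_distrib_left)
    also have "\<dots> < t / 2 * M + 1 / (2 * t) * (t * e)"
    proof (rule add_le_less_mono)
      show "t / 2 * (\<Sum>k<n. integral {u k..v k} (\<lambda>x. (cmod (w x))\<^sup>2)) \<le> t / 2 * M"
        unfolding M_def using \<open>t > 0\<close> by (intro mult_left_mono sum_integral_disjoint_le w2 sub disj) auto
      show "1 / (2 * t) * (\<Sum>k<n. v k - u k) < 1 / (2 * t) * (t * e)"
        using small \<open>t > 0\<close> by (intro mult_strict_left_mono) auto
    qed
    also have "\<dots> \<le> e" using tM \<open>t > 0\<close> by simp
    finally show "(\<Sum>k<n. cmod (integral {a..v k} w - integral {a..u k} w)) < e" .
  qed
qed

section \<open>Square-integrable functions on an interval\<close>

text \<open>A version of \<open>inH\<close> for arbitrary intervals, since Green's formula and the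
  differential equation are treated on the two pieces separately.\<close>

definition L2 :: "real \<Rightarrow> real \<Rightarrow> (real \<Rightarrow> complex) \<Rightarrow> bool" where
  "L2 a b f \<longleftrightarrow> set_borel_measurable lborel {a..b} f \<and>
              set_integrable lborel {a..b} (\<lambda>x. (cmod (f x))^2)"

lemma inH_iff_L2: "inH f \<longleftrightarrow> L2 (-pi) pi f"
  by (simp add: inH_def L2_def)

lemma L2_measurable: "L2 a b f \<Longrightarrow> (\<lambda>x. indicat_real {a..b} x *\<^sub>R f x) \<in> borel_measurable lborel"
  by (simp add: L2_def set_borel_measurable_def)

lemma set_borel_measurable_mult_complex:
  fixes f g :: "real \<Rightarrow> complex"
  assumes "set_borel_measurable lborel A f" "set_borel_measurable lborel A g"
  shows "set_borel_measurable lborel A (\<lambda>x. f x * g x)"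
proof -
  have "(\<lambda>x. (indicat_real A x *\<^sub>R f x) * (indicat_real A x *\<^sub>R g x)) \<in> borel_measurable lborel"
    using assms unfolding set_borel_measurable_def by (rule borel_measurable_times)
  moreover have "(\<lambda>x. (indicat_real A x *\<^sub>R f x) * (indicat_real A x *\<^sub>R g x)) = (\<lambda>x. indicat_real A x *\<^sub>R (f x * g x))"
    by (auto simp: fun_eq_iff split: split_indicator)
  ultimately show ?thesis unfolding set_borel_measurable_def by simp
qed

lemma set_borel_measurable_diff_complex:
  fixes f g :: "real \<Rightarrow> complex"
  assumes "set_borel_measurable lborel A f" "set_borel_measurable lborel A g"
  shows "set_borel_measurable lborel A (\<lambda>x. f x - g x)"
  using borel_measurable_diff[of "\<lambda>x. indicat_real A x *\<^sub>R f x" lborel "\<lambda>x. indicat_real A x *\<^sub>R g x"] assms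
  by (simp add: set_borel_measurable_def scaleR_diff_right)

lemma set_borel_measurable_cnj:
  assumes "set_borel_measurable lborel A f"
  shows "set_borel_measurable lborel A (\<lambda>x. cnj (f x))"
proof -
  have "(\<lambda>x. cnj (indicat_real A x *\<^sub>R f x)) \<in> borel_measurable lborel"
    using assms unfolding set_borel_measurable_def
    by (rule measurable_compose[OF _ borel_measurable_continuous_onI]) (intro continuous_intros)
  then show ?thesis by (simp add: set_borel_measurable_def)
qed

text \<open>By (s + t)^2 <= 2 (s^2 + t^2), the bound on |h| gives |h|^2 <= 2 C^2 (|f|^2 + |g|^2).
  The dominating functions may live on larger intervals, which makes restriction an instance, like
  differences and bounded multiples.\<close>

lemma L2_dominated:
  assumes h: "set_borel_measurable lborel {a..b} h" and f: "L2 c d f" and g: "L2 c' d' g"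
    and sub: "{a..b} \<subseteq> {c..d}" "{a..b} \<subseteq> {c'..d'}"
    and le: "AE x in lborel. x \<in> {a..b} \<longrightarrow> cmod (h x) \<le> C * (cmod (f x) + cmod (g x))"
  shows "L2 a b h"
  unfolding L2_def
proof
  have "integrable lborel (\<lambda>x. 2 * C\<^sup>2 * (indicat_real {c..d} x *\<^sub>R (cmod (f x))\<^sup>2 + indicat_real {c'..d'} x *\<^sub>R (cmod (g x))\<^sup>2))"
    using f g unfolding L2_def set_integrable_def
    by (intro integrable_mult_right Bochner_Integration.integrable_add) auto
  then show "set_integrable lborel {a..b} (\<lambda>x. (cmod (h x))\<^sup>2)"
    unfolding set_integrable_def
  proof (rule Bochner_Integration.integrable_bound)
    have "(\<lambda>x. (cmod (indicat_real {a..b} x *\<^sub>R h x))\<^sup>2) \<in> borel_measurable lborel"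
      using h unfolding set_borel_measurable_def by measurable
    moreover have "(\<lambda>x. (cmod (indicat_real {a..b} x *\<^sub>R h x))\<^sup>2) = (\<lambda>x. indicat_real {a..b} x *\<^sub>R (cmod (h x))\<^sup>2)"
      by (auto simp: fun_eq_iff split: split_indicator)
    ultimately show "(\<lambda>x. indicat_real {a..b} x *\<^sub>R (cmod (h x))\<^sup>2) \<in> borel_measurable lborel" by simp
    show "AE x in lborel. norm (indicat_real {a..b} x *\<^sub>R (cmod (h x))\<^sup>2)
       \<le> norm (2 * C\<^sup>2 * (indicat_real {c..d} x *\<^sub>R (cmod (f x))\<^sup>2 + indicat_real {c'..d'} x *\<^sub>R (cmod (g x))\<^sup>2))"
      using le
    proof eventually_elim
      case (elim x)
      show ?case
      proof (cases "x \<in> {a..b}")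
        case True
        then have "(cmod (h x))\<^sup>2 \<le> (C * (cmod (f x) + cmod (g x)))\<^sup>2"
          using elim by (intro power_mono) auto
        also have "\<dots> \<le> C\<^sup>2 * (2 * ((cmod (f x))\<^sup>2 + (cmod (g x))\<^sup>2))"
          unfolding power_mult_distrib using sum_squares_bound[of "cmod (f x)" "cmod (g x)"]
          by (intro mult_left_mono) (auto simp: power2_sum)
        finally show ?thesis using True sub by (auto simp: subset_iff algebra_simps)
      qed simp
    qed
  qed
qed fact

lemma L2_subset: "L2 a b f \<Longrightarrow> a \<le> c \<Longrightarrow> d \<le> b \<Longrightarrow> L2 c d f"
proof (rule L2_dominated[of c d f a b f a b f 1])
  assume "L2 a b f" "a \<le> c" "d \<le> b"
  then show "set_borel_measurable lborel {c..d} f"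
    unfolding L2_def by (intro set_borel_measurable_subset[of lborel "{a..b}" f "{c..d}"]) auto
qed auto

lemma L2_diff:
  assumes "L2 a b f" "L2 a b g"
  shows "L2 a b (\<lambda>x. f x - g x)"
proof (rule L2_dominated[OF _ assms order_refl order_refl, of _ 1])
  show "set_borel_measurable lborel {a..b} (\<lambda>x. f x - g x)"
    using assms unfolding L2_def by (intro set_borel_measurable_diff_complex) simp_all
  show "AE x in lborel. x \<in> {a..b} \<longrightarrow> cmod (f x - g x) \<le> 1 * (cmod (f x) + cmod (g x))"
    by (simp add: norm_triangle_ineq4)
qed

lemma L2_mult_bounded:
  assumes "L2 a b f" "set_borel_measurable lborel {a..b} q" "\<And>x. x \<in> {a..b} \<Longrightarrow> cmod (q x) \<le> B"
  shows "L2 a b (\<lambda>x. q x * f x)"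
proof (rule L2_dominated[OF _ assms(1,1) order_refl order_refl, of _ B])
  show "set_borel_measurable lborel {a..b} (\<lambda>x. q x * f x)"
    using assms(1,2) by (intro set_borel_measurable_mult_complex) (auto simp: L2_def)
  have "cmod (q x * f x) \<le> B * (cmod (f x) + cmod (f x))" if "x \<in> {a..b}" for x
  proof -
    have "0 \<le> B" using assms(3)[OF that] norm_ge_zero order_trans by blast
    then have "cmod (q x) * cmod (f x) \<le> B * (cmod (f x) + cmod (f x))"
      using assms(3)[OF that] by (intro mult_mono) auto
    then show ?thesis by (simp add: norm_mult)
  qed
  then show "AE x in lborel. x \<in> {a..b} \<longrightarrow> cmod (q x * f x) \<le> B * (cmod (f x) + cmod (f x))" by simp
qed

lemma L2_continuous:
  assumes "continuous_on {a..b} f"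
  shows "L2 a b f"
  unfolding L2_def
proof
  show "set_borel_measurable lborel {a..b} f"
    unfolding set_borel_measurable_def using borel_measurable_continuous_on_indicator[OF _ assms] by simp
  show "set_integrable lborel {a..b} (\<lambda>x. (cmod (f x))\<^sup>2)"
    unfolding set_integrable_def
    by (rule borel_integrable_compact[OF compact_Icc]) (intro continuous_intros assms)
qed

text \<open>The pointwise bound |f| |g| <= |f|^2 + |g|^2 stands in for the Cauchy-Schwarz
  inequality, as only integrability is at issue.\<close>

lemma L2_mult_cnj_integrable:
  assumes f: "L2 a b f" and g: "L2 a b g"
  shows "set_integrable lborel {a..b} (\<lambda>x. f x * cnj (g x))"
proof -
  have "integrable lborel (\<lambda>x. indicat_real {a..b} x *\<^sub>R (cmod (f x))\<^sup>2 + indicat_real {a..b} x *\<^sub>R (cmod (g x))\<^sup>2)"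
    using f g unfolding L2_def set_integrable_def by (intro Bochner_Integration.integrable_add) auto
  then show ?thesis
    unfolding set_integrable_def
  proof (rule Bochner_Integration.integrable_bound)
    show "(\<lambda>x. indicat_real {a..b} x *\<^sub>R (f x * cnj (g x))) \<in> borel_measurable lborel"
      using set_borel_measurable_mult_complex[OF _ set_borel_measurable_cnj] f g
      unfolding L2_def set_borel_measurable_def by blast
    have "cmod (f x) * cmod (g x) \<le> (cmod (f x))\<^sup>2 + (cmod (g x))\<^sup>2" for x
    proof -
      have "0 \<le> cmod (f x) * cmod (g x)" by simp
      then show ?thesis using sum_squares_bound[of "cmod (f x)" "cmod (g x)"] by linarith
    qed
    then show "AE x in lborel. norm (indicat_real {a..b} x *\<^sub>R (f x * cnj (g x)))
       \<le> norm (indicat_real {a..b} x *\<^sub>R (cmod (f x))\<^sup>2 + indicat_real {a..b} x *\<^sub>R (cmod (g x))\<^sup>2)"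
      by (auto simp: norm_mult split: split_indicator)
  qed
qed

text \<open>On a bounded interval the constant 1 is square-integrable, and f is paired with
  it.\<close>

lemma L2_set_integrable: "L2 a b f \<Longrightarrow> set_integrable lborel {a..b} f"
  using L2_mult_cnj_integrable[of a b f "\<lambda>_. 1"] L2_continuous[of a b "\<lambda>_. 1"] by simp

lemma L2_AC_on_integral:
  assumes "L2 a b w"
  shows "AC_on {a..b} (\<lambda>x. integral {a..x} w)"
proof (rule AC_on_integral)
  show "w absolutely_integrable_on {a..b}"
    using L2_set_integrable[OF assms] L2_measurable[OF assms]
    unfolding set_integrable_def by (simp add: integrable_completion)
  show "(\<lambda>x. (cmod (w x))\<^sup>2) integrable_on {a..b}"
    using assms unfolding L2_def by (blast intro: set_borel_integral_eq_integral)
qed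

section \<open>Green's formula and the equation \<open>-y'' = g\<close>\<close>

text \<open>The equation -y'' = g in the Caratheodory sense, with \<open>yd\<close> as a named first
  derivative. Values at the endpoints do not occur, so both half-open pieces of the domain fit, and
  boundary data enter as one-sided limits.\<close>

definition ode_on :: "real \<Rightarrow> real \<Rightarrow> (real \<Rightarrow> complex) \<Rightarrow> (real \<Rightarrow> complex) \<Rightarrow> (real \<Rightarrow> complex) \<Rightarrow> bool" where
  "ode_on a b y yd g \<longleftrightarrow> AC_on {a<..<b} y \<and> AC_on {a<..<b} yd \<and>
     (\<forall>x\<in>{a<..<b}. (y has_vector_derivative yd x) (at x)) \<and>
     (AE x in lborel. x \<in> {a<..<b} \<longrightarrow> (yd has_vector_derivative - g x) (at x))"

text \<open>The Lagrange bracket of the sesquilinear Green formula, that is, the Wronskian of y and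
  the conjugate of z.\<close>

definition wronskian :: "complex \<Rightarrow> complex \<Rightarrow> complex \<Rightarrow> complex \<Rightarrow> complex" where
  "wronskian y yd z zd = y * cnj zd - yd * cnj z"

lemma AE_lborel_negligible:
  assumes "AE x in lborel. P (x::real)"
  obtains N where "negligible N" "\<And>x. x \<notin> N \<Longrightarrow> P x"
proof -
  obtain N where "N \<in> null_sets lborel" "{x. \<not> P x} \<subseteq> N"
    using assms by (auto simp: eventually_ae_filter)
  then have "negligible N" "\<And>x. x \<notin> N \<Longrightarrow> P x"
    by (auto simp: negligible_iff_null_sets null_sets_completionI)
  with that show thesis by blast
qed

text \<open>Differentiating the bracket cancels the products of first derivatives and leaves the
  integrand almost everywhere. On a compact subinterval the factors are bounded, so the bracket is
  again absolutely continuous.\<close>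

lemma green_interior:
  assumes y: "ode_on a b y yd g" and z: "ode_on a b z zd w" and cd: "a < c" "c \<le> d" "d < b"
  shows "((\<lambda>x. g x * cnj (z x) - y x * cnj (w x)) has_integral
     wronskian (y d) (yd d) (z d) (zd d) - wronskian (y c) (yd c) (z c) (zd c)) {c..d}"
proof -
  have sub: "{c..d} \<subseteq> {a<..<b}" using cd by auto
  obtain N1 where N1: "negligible N1" "\<And>x. x \<notin> N1 \<Longrightarrow> x \<in> {a<..<b} \<longrightarrow> (yd has_vector_derivative - g x) (at x)"
    using y unfolding ode_on_def by (elim conjE AE_lborel_negligible) blast
  obtain N2 where N2: "negligible N2" "\<And>x. x \<notin> N2 \<Longrightarrow> x \<in> {a<..<b} \<longrightarrow> (zd has_vector_derivative - w x) (at x)"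
    using z unfolding ode_on_def by (elim conjE AE_lborel_negligible) blast
  have AC: "AC_on {c..d} y" "AC_on {c..d} yd" "AC_on {c..d} z" "AC_on {c..d} zd"
    using y z AC_on_subset[OF _ sub] unfolding ode_on_def by blast+
  show ?thesis
  proof (rule has_integral_AC_on[where N = "N1 \<union> N2"])
    show "AC_on {c..d} (\<lambda>x. wronskian (y x) (yd x) (z x) (zd x))"
      unfolding wronskian_def by (intro AC_on_diff AC_on_mult AC_on_cnj AC)
    show "negligible (N1 \<union> N2)" using N1 N2 by (intro negligible_Un)
    fix x assume x: "x \<in> {c..d} - (N1 \<union> N2)"
    then have xab: "x \<in> {a<..<b}" using sub by blast
    have "(y has_vector_derivative yd x) (at x)" "(z has_vector_derivative zd x) (at x)"
      using y z xab unfolding ode_on_def by auto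
    moreover have "(yd has_vector_derivative - g x) (at x)" "(zd has_vector_derivative - w x) (at x)"
      using N1(2) N2(2) x xab by auto
    ultimately have "((\<lambda>x. y x * cnj (zd x) - yd x * cnj (z x)) has_vector_derivative
        (y x * cnj (- w x) + yd x * cnj (zd x)) - (yd x * cnj (zd x) + - g x * cnj (z x))) (at x)"
      by (intro has_vector_derivative_diff has_vector_derivative_mult has_vector_derivative_cnj)
    then have "((\<lambda>x. wronskian (y x) (yd x) (z x) (zd x)) has_vector_derivative
        g x * cnj (z x) - y x * cnj (w x)) (at x)"
      by (simp add: wronskian_def algebra_simps)
    then show "((\<lambda>x. wronskian (y x) (yd x) (z x) (zd x)) has_vector_derivative
        g x * cnj (z x) - y x * cnj (w x)) (at x within {c..d})"
      by (rule has_vector_derivative_at_within)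
  qed fact
qed

text \<open>On the open interval the bracket \<open>W\<close> and the indefinite integral
  \<open>H\<close> differ by a constant. \<open>H\<close> is continuous up to the endpoints, so
  comparing limits at both ends identifies the boundary terms without using values of y or z
  there.\<close>

lemma green_formula:
  assumes "a < b" and y: "ode_on a b y yd g" and z: "ode_on a b z zd w"
    and L2: "L2 a b y" "L2 a b g" "L2 a b z" "L2 a b w"
    and lim_a: "(y \<longlongrightarrow> ya) (at_right a)" "(yd \<longlongrightarrow> yda) (at_right a)"
      "(z \<longlongrightarrow> za) (at_right a)" "(zd \<longlongrightarrow> zda) (at_right a)"
    and lim_b: "(y \<longlongrightarrow> yb) (at_left b)" "(yd \<longlongrightarrow> ydb) (at_left b)"
      "(z \<longlongrightarrow> zb) (at_left b)" "(zd \<longlongrightarrow> zdb) (at_left b)"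
  shows "(LINT x:{a..b}|lborel. g x * cnj (z x)) - (LINT x:{a..b}|lborel. y x * cnj (w x))
    = wronskian yb ydb zb zdb - wronskian ya yda za zda"
proof -
  define h where "h x = g x * cnj (z x) - y x * cnj (w x)" for x
  define W where "W x = wronskian (y x) (yd x) (z x) (zd x)" for x
  define H where "H x = integral {a..x} h" for x
  have int: "set_integrable lborel {a..b} h"
    unfolding h_def using L2 by (intro set_integral_diff L2_mult_cnj_integrable)
  have h: "h integrable_on {a..b}" "(LINT x:{a..b}|lborel. h x) = H b"
    using set_borel_integral_eq_integral[OF int] by (auto simp: H_def)
  have W_diff: "H d - H c = W d - W c" if "a < c" "c \<le> d" "d < b" for c d
  proof -
    have "integral {a..c} h + integral {c..d} h = integral {a..d} h"
      using that by (intro Henstock_Kurzweil_Integration.integral_combine integrable_on_subinterval[OF h(1)]) auto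
    moreover have "integral {c..d} h = W d - W c"
      unfolding h_def W_def by (rule integral_unique[OF green_interior[OF y z that]])
    ultimately show ?thesis by (simp add: H_def algebra_simps)
  qed
  define m where "m = (a + b) / 2"
  have m: "a < m" "m < b" using \<open>a < b\<close> by (auto simp: m_def)
  have W_eq: "W x = H x + (W m - H m)" if "x \<in> {a<..<b}" for x
    using W_diff[of x m] W_diff[of m x] that m by (cases "x \<le> m") (auto simp: algebra_simps)
  have H_cont: "continuous_on {a..b} H"
    unfolding H_def by (rule indefinite_integral_continuous_1[OF h(1)])
  have "((\<lambda>x. H x + (W m - H m)) \<longlongrightarrow> H b + (W m - H m)) (at_left b)"
    using H_cont \<open>a < b\<close> by (intro tendsto_intros) (auto simp: continuous_on_def at_within_Icc_at_left dest: bspec[of _ _ b])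
  moreover have "(W \<longlongrightarrow> wronskian yb ydb zb zdb) (at_left b)"
    unfolding W_def wronskian_def by (intro tendsto_intros lim_b)
  then have "((\<lambda>x. H x + (W m - H m)) \<longlongrightarrow> wronskian yb ydb zb zdb) (at_left b)"
    by (rule Lim_transform_eventually)
       (use W_eq eventually_at_left_real[OF \<open>a < b\<close>] in \<open>auto elim: eventually_mono\<close>)
  ultimately have b: "wronskian yb ydb zb zdb = H b + (W m - H m)"
    by (intro tendsto_unique) auto
  have "((\<lambda>x. H x + (W m - H m)) \<longlongrightarrow> H a + (W m - H m)) (at_right a)"
    using H_cont \<open>a < b\<close> by (intro tendsto_intros) (auto simp: continuous_on_def at_within_Icc_at_right dest: bspec[of _ _ a])
  moreover have "(W \<longlongrightarrow> wronskian ya yda za zda) (at_right a)"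
    unfolding W_def wronskian_def by (intro tendsto_intros lim_a)
  then have "((\<lambda>x. H x + (W m - H m)) \<longlongrightarrow> wronskian ya yda za zda) (at_right a)"
    by (rule Lim_transform_eventually)
       (use W_eq eventually_at_right_real[OF \<open>a < b\<close>] in \<open>auto elim: eventually_mono\<close>)
  ultimately have a: "wronskian ya yda za zda = H a + (W m - H m)"
    by (intro tendsto_unique) auto
  have "(LINT x:{a..b}|lborel. h x) =
      (LINT x:{a..b}|lborel. g x * cnj (z x)) - (LINT x:{a..b}|lborel. y x * cnj (w x))"
    unfolding h_def using L2 by (intro set_integral_diff L2_mult_cnj_integrable)
  with a b h(2) show ?thesis by (simp add: H_def)
qed

text \<open>The form in which solutions are constructed: with one-sided derivatives at the
  endpoints, boundary data are plain function values. Absolute continuity of \<open>y\<close>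
  follows from continuity of \<open>yd\<close>.\<close>

definition ode_on_closed :: "real \<Rightarrow> real \<Rightarrow> (real \<Rightarrow> complex) \<Rightarrow> (real \<Rightarrow> complex) \<Rightarrow> (real \<Rightarrow> complex) \<Rightarrow> bool" where
  "ode_on_closed a b y yd g \<longleftrightarrow>
     (\<forall>x\<in>{a..b}. (y has_vector_derivative yd x) (at x within {a..b})) \<and> AC_on {a..b} yd \<and>
     (AE x in lborel. x \<in> {a<..<b} \<longrightarrow> (yd has_vector_derivative - g x) (at x))"

lemma AC_on_C1:
  assumes "\<And>x. x \<in> {a..b} \<Longrightarrow> (y has_vector_derivative yd x) (at x within {a..b})" "continuous_on {a..b} yd"
  shows "AC_on {a..b} y"
proof (rule AC_on_cong)
  show "AC_on {a..b} (\<lambda>x. y a + integral {a..x} yd)"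
    by (intro AC_on_add_const L2_AC_on_integral L2_continuous assms)
  fix x assume x: "x \<in> {a..b}"
  have "(yd has_integral y x - y a) {a..x}"
    using x assms(1) by (intro fundamental_theorem_of_calculus has_vector_derivative_within_subset[OF assms(1)]) auto
  then show "y x = y a + integral {a..x} yd" by (simp add: integral_unique)
qed

lemma ode_on_closedD:
  assumes "ode_on_closed a b y yd g"
  shows "AC_on {a..b} y" "AC_on {a..b} yd" "continuous_on {a..b} y" "continuous_on {a..b} yd" "ode_on a b y yd g"
proof -
  show yd: "AC_on {a..b} yd" using assms by (simp add: ode_on_closed_def)
  then show "continuous_on {a..b} yd" by (rule AC_on_continuous_on) simp
  then show y: "AC_on {a..b} y"
    using assms by (intro AC_on_C1[of a b y yd]) (auto simp: ode_on_closed_def)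
  then show "continuous_on {a..b} y" by (rule AC_on_continuous_on) simp
  have sub: "{a<..<b} \<subseteq> {a..b}" by auto
  have "(y has_vector_derivative yd x) (at x)" if "x \<in> {a<..<b}" for x
  proof -
    have "at x within {a..b} = at x" using that by (intro at_within_interior) (simp add: interior_atLeastAtMost_real)
    moreover have "x \<in> {a..b}" using that by simp
    ultimately show ?thesis using assms unfolding ode_on_closed_def by metis
  qed
  then show "ode_on a b y yd g"
    using assms AC_on_subset[OF y sub] AC_on_subset[OF yd sub] unfolding ode_on_def ode_on_closed_def by blast
qed

lemma continuous_on_Icc_tendsto:
  fixes f :: "real \<Rightarrow> 'a::topological_space"
  assumes "continuous_on {a..b} f" "a < b"
  shows "(f \<longlongrightarrow> f a) (at_right a)" "(f \<longlongrightarrow> f b) (at_left b)"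
  using assms continuous_on_Icc_at_rightD continuous_on_Icc_at_leftD by blast+

text \<open>Integrate -w twice from a; Lebesgue differentiation supplies yd' = -w almost
  everywhere.\<close>

lemma ode_exists:
  assumes w: "L2 a b w" and "a < b"
  obtains y yd where "ode_on_closed a b y yd w" "y a = 0" "yd a = 0"
proof -
  define yd where "yd x = - integral {a..x} w" for x
  define y where "y x = integral {a..x} yd" for x
  have wi: "w integrable_on {a..b}"
    using L2_set_integrable[OF w] by (rule set_borel_integral_eq_integral)
  have AC: "AC_on {a..b} yd"
    unfolding yd_def by (intro AC_on_minus L2_AC_on_integral w)
  show thesis
  proof
    show "y a = 0" "yd a = 0" by (simp_all add: y_def yd_def)
    show "ode_on_closed a b y yd w"
      unfolding ode_on_closed_def
    proof (intro conjI ballI)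
      show "AC_on {a..b} yd" by fact
      fix x assume "x \<in> {a..b}"
      then show "(y has_vector_derivative yd x) (at x within {a..b})"
        unfolding y_def using AC_on_continuous_on[OF AC] by (intro integral_has_vector_derivative) simp_all
    next
      show "AE x in lborel. x \<in> {a<..<b} \<longrightarrow> (yd has_vector_derivative - w x) (at x)"
        using AE_has_vector_derivative_integral[OF wi] unfolding yd_def
        by eventually_elim (auto intro: has_vector_derivative_minus)
    qed
  qed
qed

lemma ode_on_closed_cong:
  assumes "ode_on_closed a b y yd g" "\<And>x. x \<in> {a<..<b} \<Longrightarrow> g' x = g x"
  shows "ode_on_closed a b y yd g'"
  using assms unfolding ode_on_closed_def by (auto elim: eventually_mono)

section \<open>Prescribing moments and boundary data\<close>

lemma L2_const: "L2 a b (\<lambda>_. c)"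
  by (intro L2_continuous continuous_intros)

lemma L2_piecewise:
  assumes "a \<le> c" "c \<le> b" and f: "continuous_on {a..c} f" and g: "continuous_on {c..b} g"
  shows "L2 a b (\<lambda>x. if x < c then f x else g x)"
proof -
  have "\<exists>B. \<forall>x\<in>{u..v}. cmod (h x) \<le> B" if "continuous_on {u..v} h"
    for u v :: real and h :: "real \<Rightarrow> complex"
    using compact_imp_bounded[OF compact_continuous_image[OF that compact_Icc]]
    by (auto simp: bounded_iff)
  then obtain A B where A: "\<And>x. x \<in> {a..c} \<Longrightarrow> cmod (f x) \<le> A" and B: "\<And>x. x \<in> {c..b} \<Longrightarrow> cmod (g x) \<le> B"
    using f g by metis
  show ?thesis
  proof (rule L2_dominated[OF _ L2_const[of a b "of_real A"] L2_const[of a b "of_real B"] order_refl order_refl, of _ 1])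
    have "(\<lambda>x. indicat_real {a..<c} x *\<^sub>R f x + indicat_real {c..b} x *\<^sub>R g x) \<in> borel_measurable lborel"
      using borel_measurable_continuous_on_indicator[OF _ continuous_on_subset[OF f atLeastLessThan_subseteq_atLeastAtMost_iff[THEN iffD2, of a c a c]]]
        borel_measurable_continuous_on_indicator[OF _ g] by (intro borel_measurable_add) simp_all
    moreover have "indicat_real {a..<c} x *\<^sub>R f x + indicat_real {c..b} x *\<^sub>R g x
        = indicat_real {a..b} x *\<^sub>R (if x < c then f x else g x)" for x
      using assms(1,2) by (auto split: split_indicator)
    ultimately show "set_borel_measurable lborel {a..b} (\<lambda>x. if x < c then f x else g x)"
      unfolding set_borel_measurable_def by simp
    have "cmod (if x < c then f x else g x) \<le> \<bar>A\<bar> + \<bar>B\<bar>" if "x \<in> {a..b}" for x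
      using A[of x] B[of x] that by (cases "x < c") auto
    then show "AE x in lborel. x \<in> {a..b} \<longrightarrow> cmod (if x < c then f x else g x)
        \<le> 1 * (cmod (of_real A) + cmod (of_real B))" by simp
  qed
qed

text \<open>The left side is the Gram determinant of 1 and x in L2(a, b) for real a < b; the closed
  form shows that it does not vanish.\<close>

lemma moment_matrix_det:
  fixes a b :: complex
  shows "(b - a) * ((b ^ 3 - a ^ 3) / 3) - ((b\<^sup>2 - a\<^sup>2) / 2)\<^sup>2 = (b - a) ^ 4 / 12"
  by (simp add: field_simps power2_eq_square power3_eq_cube power4_eq_xxxx)

text \<open>The affine function is the orthogonal projection of \<open>e\<close>. With the moments
  \<open>m0\<close>, \<open>m1\<close>, \<open>m2\<close> of the interval, \<open>c0\<close> and
  \<open>c1\<close> come from Cramer's rule for the two normal equations.\<close>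

lemma affine_part_exists:
  assumes e: "L2 a b e" and "a < b"
  obtains c0 c1 where "(LINT x:{a..b}|lborel. (e x - (c0 + c1 * of_real x)) * cnj 1) = 0"
    "(LINT x:{a..b}|lborel. (e x - (c0 + c1 * of_real x)) * cnj (of_real x)) = 0"
proof -
  define A B where "A = complex_of_real a" and "B = complex_of_real b"
  define I0 I1 where "I0 = (LINT x:{a..b}|lborel. e x * cnj 1)" and "I1 = (LINT x:{a..b}|lborel. e x * cnj (of_real x))"
  define m0 m1 m2 where "m0 = B - A" and "m1 = (B\<^sup>2 - A\<^sup>2) / 2" and "m2 = (B ^ 3 - A ^ 3) / 3"
  define \<Delta> where "\<Delta> = m0 * m2 - m1\<^sup>2"
  have "\<Delta> = (B - A) ^ 4 / 12" unfolding \<Delta>_def m0_def m1_def m2_def by (rule moment_matrix_det)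
  moreover have "(B - A) ^ 4 / 12 \<noteq> 0" using \<open>a < b\<close> by (simp add: A_def B_def)
  ultimately have "\<Delta> \<noteq> 0" by metis
  have poly: "(LINT x:{a..b}|lborel. p x) = P b - P a"
    if "\<And>x. (P has_vector_derivative p x) (at x)" "continuous_on {a..b} p" for p P :: "real \<Rightarrow> complex"
  proof -
    have "set_integrable lborel {a..b} p" by (rule L2_set_integrable[OF L2_continuous[OF that(2)]])
    moreover have "(p has_integral P b - P a) {a..b}"
      by (rule fundamental_theorem_of_calculus[OF less_imp_le[OF \<open>a < b\<close>] has_vector_derivative_at_within[OF that(1)]])
    ultimately show ?thesis by (simp add: set_borel_integral_eq_integral(2) integral_unique)
  qed
  define c0 c1 where "c0 = (I0 * m2 - I1 * m1) / \<Delta>" and "c1 = (m0 * I1 - m1 * I0) / \<Delta>"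
  have "((\<lambda>z. c0 * z + c1 * z\<^sup>2 / 2) has_field_derivative c0 + c1 * z) (at z)" for z
    by (rule derivative_eq_intros refl | simp)+
  from has_vector_derivative_real_field[OF this]
  have "(LINT x:{a..b}|lborel. c0 + c1 * of_real x) = (c0 * B + c1 * B\<^sup>2 / 2) - (c0 * A + c1 * A\<^sup>2 / 2)"
    unfolding A_def B_def
    by (rule poly[where P = "\<lambda>x. c0 * of_real x + c1 * (of_real x)\<^sup>2 / 2" and p = "\<lambda>x. c0 + c1 * of_real x"]) (intro continuous_intros)
  then have q0: "(LINT x:{a..b}|lborel. (c0 + c1 * of_real x) * cnj 1) = c0 * m0 + c1 * m1"
    by (simp add: m0_def m1_def algebra_simps diff_divide_distrib)
  have "((\<lambda>z. c0 * z\<^sup>2 / 2 + c1 * z ^ 3 / 3) has_field_derivative (c0 + c1 * z) * z) (at z)" for z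
    by (rule derivative_eq_intros refl | simp add: algebra_simps power2_eq_square)+
  from has_vector_derivative_real_field[OF this]
  have "(LINT x:{a..b}|lborel. (c0 + c1 * of_real x) * of_real x)
      = (c0 * B\<^sup>2 / 2 + c1 * B ^ 3 / 3) - (c0 * A\<^sup>2 / 2 + c1 * A ^ 3 / 3)"
    unfolding A_def B_def
    by (rule poly[where P = "\<lambda>x. c0 * (of_real x)\<^sup>2 / 2 + c1 * (of_real x) ^ 3 / 3" and p = "\<lambda>x. (c0 + c1 * of_real x) * of_real x"]) (intro continuous_intros)
  then have q1: "(LINT x:{a..b}|lborel. (c0 + c1 * of_real x) * cnj (of_real x)) = c0 * m1 + c1 * m2"
    by (simp add: m1_def m2_def algebra_simps diff_divide_distrib)
  have lin: "L2 a b (\<lambda>x. c0 + c1 * of_real x)" "L2 a b (\<lambda>x. of_real x)"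
    by (auto intro!: L2_continuous continuous_intros)
  show thesis
  proof
    have "c0 * m0 + c1 * m1 = I0" "c0 * m1 + c1 * m2 = I1"
      using \<open>\<Delta> \<noteq> 0\<close> unfolding c0_def c1_def by (simp_all add: divide_simps) (simp_all add: \<Delta>_def algebra_simps power2_eq_square)
    then show "(LINT x:{a..b}|lborel. (e x - (c0 + c1 * of_real x)) * cnj 1) = 0"
        "(LINT x:{a..b}|lborel. (e x - (c0 + c1 * of_real x)) * cnj (of_real x)) = 0"
      using q0 q1 I0_def I1_def
        set_integral_diff(2)[OF L2_mult_cnj_integrable[OF e L2_const[of a b 1]] L2_mult_cnj_integrable[OF lin(1) L2_const[of a b 1]]]
        set_integral_diff(2)[OF L2_mult_cnj_integrable[OF e lin(2)] L2_mult_cnj_integrable[OF lin]]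
      by (simp_all add: left_diff_distrib)
  qed
qed

lemma ode_on_closed_affine: "ode_on_closed a b (\<lambda>x. c0 + c1 * of_real x) (\<lambda>_. c1) (\<lambda>_. 0)"
  unfolding ode_on_closed_def
proof (intro conjI ballI AE_I2 impI)
  have "AC_on {a..b} (\<lambda>x. c1 + integral {a..x} (\<lambda>_. 0))"
    by (intro AC_on_add_const L2_AC_on_integral L2_const)
  then show "AC_on {a..b} (\<lambda>_. c1)" by simp
qed (auto intro!: derivative_eq_intros)

lemma ode_on_closed_add_affine:
  assumes "ode_on_closed a b y yd g"
  shows "ode_on_closed a b (\<lambda>x. y x + (c0 + c1 * of_real x)) (\<lambda>x. c1 + yd x) g"
  unfolding ode_on_closed_def
proof (intro conjI ballI)
  show "AC_on {a..b} (\<lambda>x. c1 + yd x)" using assms by (intro AC_on_add_const) (simp add: ode_on_closed_def)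
  show "AE x in lborel. x \<in> {a<..<b} \<longrightarrow> ((\<lambda>x. c1 + yd x) has_vector_derivative - g x) (at x)"
    using assms unfolding ode_on_closed_def by (auto elim!: eventually_mono intro!: derivative_eq_intros)
  fix x assume "x \<in> {a..b}"
  then have "(y has_vector_derivative yd x) (at x within {a..b})" using assms by (simp add: ode_on_closed_def)
  then show "((\<lambda>x. y x + (c0 + c1 * of_real x)) has_vector_derivative c1 + yd x) (at x within {a..b})"
    by (auto intro!: derivative_eq_intros)
qed

text \<open>Start with zero data at a. By Green's formula against an affine z, for which z'' = 0,
  the pairing of f with z equals the bracket at b; z = 1 gives yd b = 0, and then z = x gives y b =
  0.\<close>

lemma ode_zero_boundary:
  assumes f: "L2 a b f" and "a < b" and orth: "(LINT x:{a..b}|lborel. f x * cnj 1) = 0"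
    "(LINT x:{a..b}|lborel. f x * cnj (of_real x)) = 0"
  obtains y yd where "ode_on_closed a b y yd f" "y a = 0" "yd a = 0" "y b = 0" "yd b = 0"
proof -
  obtain y yd where y: "ode_on_closed a b y yd f" "y a = 0" "yd a = 0" using ode_exists[OF f \<open>a < b\<close>] .
  note yD = ode_on_closedD[OF y(1)]
  have green: "(LINT x:{a..b}|lborel. f x * cnj (c0 + c1 * of_real x)) = wronskian (y b) (yd b) (c0 + c1 * of_real b) c1" for c0 c1
  proof -
    note zD = ode_on_closedD[OF ode_on_closed_affine[of a b c0 c1]]
    have "(LINT x:{a..b}|lborel. f x * cnj (c0 + c1 * of_real x)) - (LINT x:{a..b}|lborel. y x * cnj 0)
       = wronskian (y b) (yd b) (c0 + c1 * of_real b) c1 - wronskian (y a) (yd a) (c0 + c1 * of_real a) c1"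
      by (intro green_formula[OF \<open>a < b\<close> yD(5) zD(5)] f L2_continuous[OF yD(3)] L2_continuous[OF zD(3)] L2_const
          continuous_on_Icc_tendsto[OF yD(3) \<open>a < b\<close>] continuous_on_Icc_tendsto[OF yD(4) \<open>a < b\<close>]
          continuous_on_Icc_tendsto[OF zD(3) \<open>a < b\<close>] continuous_on_Icc_tendsto[OF zD(4) \<open>a < b\<close>])
    then show ?thesis using y by (simp add: wronskian_def)
  qed
  show thesis
    using that[OF y] green[of 1 0] green[of 0 1] orth by (auto simp: wronskian_def)
qed

lemma ode_on_closed_C2:
  assumes "\<And>x. (y has_vector_derivative yd x) (at x)" "\<And>x. (yd has_vector_derivative ydd x) (at x)"
    and "continuous_on {a..b} ydd"
  shows "ode_on_closed a b y yd (\<lambda>x. - ydd x)"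
  unfolding ode_on_closed_def
  using assms by (auto intro!: AC_on_C1[of a b yd ydd] intro: has_vector_derivative_at_within)

text \<open>The four data fix the four coefficients of a cubic in x - a; \<open>c2\<close> and
  \<open>c3\<close> solve the two equations at b.\<close>

lemma hermite_interpolation:
  assumes "a < b"
  obtains y yd g where "ode_on_closed a b y yd g" "continuous_on {a..b} g"
    "y a = ya" "yd a = yda" "y b = yb" "yd b = ydb"
proof -
  define h where "h = complex_of_real (b - a)"
  have "h \<noteq> 0" using assms by (simp add: h_def)
  define c2 c3 where "c2 = (3 * (yb - ya) - h * (2 * yda + ydb)) / h\<^sup>2"
    and "c3 = (2 * (ya - yb) + h * (yda + ydb)) / h ^ 3"
  define y where "y x = ya + yda * of_real (x - a) + c2 * (of_real (x - a))\<^sup>2 + c3 * (of_real (x - a)) ^ 3" for x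
  define yd where "yd x = yda + 2 * c2 * of_real (x - a) + 3 * c3 * (of_real (x - a))\<^sup>2" for x
  define ydd where "ydd x = 2 * c2 + 6 * c3 * of_real (x - a)" for x
  have y: "(y has_vector_derivative yd x) (at x)" for x
    unfolding y_def yd_def by (auto intro!: derivative_eq_intros has_vector_derivative_real_field)
  have yd: "(yd has_vector_derivative ydd x) (at x)" for x
    unfolding yd_def ydd_def by (auto intro!: derivative_eq_intros has_vector_derivative_real_field)
  have ydd: "continuous_on {a..b} ydd" unfolding ydd_def by (intro continuous_intros)
  show thesis
  proof
    show "ode_on_closed a b y yd (\<lambda>x. - ydd x)" by (rule ode_on_closed_C2[OF y yd ydd])
    show "continuous_on {a..b} (\<lambda>x. - ydd x)" using ydd by (intro continuous_intros)
    show "y a = ya" "yd a = yda" by (simp_all add: y_def yd_def)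
    show "y b = yb" "yd b = ydb"
      using \<open>h \<noteq> 0\<close> unfolding y_def yd_def c2_def c3_def h_def[symmetric]
      by (simp_all add: field_simps power2_eq_square power3_eq_cube)
  qed
qed

section \<open>Boundary data and the free operator\<close>

text \<open>The letters l, m, p, r mark the points \<open>-\<pi>\<close>, \<open>0-\<close>, \<open>0+\<close>, \<open>\<pi>\<close>; \<open>d\<close> marks the derivative.\<close>

definition has_traces :: "(real \<Rightarrow> complex) \<Rightarrow> (real \<Rightarrow> complex) \<Rightarrow> complex \<Rightarrow> complex \<Rightarrow> complex \<Rightarrow> complex
    \<Rightarrow> complex \<Rightarrow> complex \<Rightarrow> complex \<Rightarrow> complex \<Rightarrow> bool" where
  "has_traces y g yl ydl ym ydm yp ydp yr ydr \<longleftrightarrow> inH y \<and> inH g \<and>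
     (\<exists>yd. ode_on (-pi) 0 y yd g \<and> ode_on 0 pi y yd g \<and>
        (y \<longlongrightarrow> yl) (at_right (-pi)) \<and> (yd \<longlongrightarrow> ydl) (at_right (-pi)) \<and>
        (y \<longlongrightarrow> ym) (at_left 0) \<and> (yd \<longlongrightarrow> ydm) (at_left 0) \<and>
        (y \<longlongrightarrow> yp) (at_right 0) \<and> (yd \<longlongrightarrow> ydp) (at_right 0) \<and>
        (y \<longlongrightarrow> yr) (at_left pi) \<and> (yd \<longlongrightarrow> ydr) (at_left pi))"

lemma inH_L2: "inH f \<Longrightarrow> L2 (-pi) 0 f" "inH f \<Longrightarrow> L2 0 pi f"
  by (auto simp: inH_iff_L2 intro: L2_subset)

lemma ipH_green:
  assumes y: "has_traces y g yl ydl ym ydm yp ydp yr ydr" and z: "has_traces z w zl zdl zm zdm zp zdp zr zdr"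
  shows "ipH r1 r2 g z = ipH r1 r2 y w
    + of_real r1 * (wronskian ym ydm zm zdm - wronskian yl ydl zl zdl)
    + of_real r2 * (wronskian yr ydr zr zdr - wronskian yp ydp zp zdp)"
proof -
  obtain yd where yd: "inH y" "inH g" "ode_on (-pi) 0 y yd g" "ode_on 0 pi y yd g"
    "(y \<longlongrightarrow> yl) (at_right (-pi))" "(yd \<longlongrightarrow> ydl) (at_right (-pi))"
    "(y \<longlongrightarrow> ym) (at_left 0)" "(yd \<longlongrightarrow> ydm) (at_left 0)"
    "(y \<longlongrightarrow> yp) (at_right 0)" "(yd \<longlongrightarrow> ydp) (at_right 0)"
    "(y \<longlongrightarrow> yr) (at_left pi)" "(yd \<longlongrightarrow> ydr) (at_left pi)"
    using y unfolding has_traces_def by blast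
  obtain zd where zd: "inH z" "inH w" "ode_on (-pi) 0 z zd w" "ode_on 0 pi z zd w"
    "(z \<longlongrightarrow> zl) (at_right (-pi))" "(zd \<longlongrightarrow> zdl) (at_right (-pi))"
    "(z \<longlongrightarrow> zm) (at_left 0)" "(zd \<longlongrightarrow> zdm) (at_left 0)"
    "(z \<longlongrightarrow> zp) (at_right 0)" "(zd \<longlongrightarrow> zdp) (at_right 0)"
    "(z \<longlongrightarrow> zr) (at_left pi)" "(zd \<longlongrightarrow> zdr) (at_left pi)"
    using z unfolding has_traces_def by blast
  have "(LINT x:{-pi..0}|lborel. g x * cnj (z x)) - (LINT x:{-pi..0}|lborel. y x * cnj (w x))
      = wronskian ym ydm zm zdm - wronskian yl ydl zl zdl"
    using yd zd by (intro green_formula[of "-pi" 0 y yd g z zd w] inH_L2) simp_all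
  moreover have "(LINT x:{0..pi}|lborel. g x * cnj (z x)) - (LINT x:{0..pi}|lborel. y x * cnj (w x))
      = wronskian yr ydr zr zdr - wronskian yp ydp zp zdp"
    using yd zd by (intro green_formula[of 0 pi y yd g z zd w] inH_L2) simp_all
  ultimately show ?thesis
    unfolding ipH_def diff_eq_eq by (simp only:) (simp only: distrib_left distrib_right ac_simps)
qed

lemma AC_on_tendsto:
  assumes "AC_on S f"
  shows "{a..c} \<subseteq> S \<Longrightarrow> a < c \<Longrightarrow> (f \<longlongrightarrow> f a) (at_right a)"
    and "{c..b} \<subseteq> S \<Longrightarrow> c < b \<Longrightarrow> (f \<longlongrightarrow> f b) (at_left b)"
  using AC_on_continuous_on[OF AC_on_subset[OF assms]] continuous_on_Icc_tendsto[of _ _ f] is_interval_cc by blast+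

lemma ode_on_piece_ok:
  assumes "piece_ok S y yd" "{a<..<b} \<subseteq> S"
    and "AE x in lborel. x \<in> {a<..<b} \<longrightarrow> (yd has_vector_derivative - g x) (at x)"
  shows "ode_on a b y yd g"
  unfolding ode_on_def
proof (intro conjI ballI assms(3))
  show "AC_on {a<..<b} y" "AC_on {a<..<b} yd"
    using assms(1,2) unfolding piece_ok_def by (auto intro: AC_on_subset)
  fix x assume x: "x \<in> {a<..<b}"
  then have "at x within S = at x"
    using assms(2) by (intro at_within_interior) (auto intro: interiorI[of "{a<..<b}"])
  moreover have "(y has_vector_derivative yd x) (at x within S)"
    using assms(1,2) x unfolding piece_ok_def by blast
  ultimately show "(y has_vector_derivative yd x) (at x)" by simp
qed

lemma ode_on_cong:
  assumes "ode_on a b y yd g" "\<And>x. x \<in> {a<..<b} \<Longrightarrow> y' x = y x" "\<And>x. x \<in> {a<..<b} \<Longrightarrow> yd' x = yd x"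
    "\<And>x. x \<in> {a<..<b} \<Longrightarrow> g' x = g x"
  shows "ode_on a b y' yd' g'"
  unfolding ode_on_def
proof (intro conjI ballI)
  show "AC_on {a<..<b} y'" "AC_on {a<..<b} yd'"
    using assms unfolding ode_on_def by (auto intro: AC_on_cong)
  show "(y' has_vector_derivative yd' x) (at x)" if x: "x \<in> {a<..<b}" for x
  proof (rule has_vector_derivative_transform_within_open[OF _ open_greaterThanLessThan x])
    show "(y has_vector_derivative yd' x) (at x)" using assms x unfolding ode_on_def by simp
  qed (use assms in simp)
  have "(yd' has_vector_derivative - g' x) (at x)"
    if x: "x \<in> {a<..<b}" and d: "(yd has_vector_derivative - g x) (at x)" for x
    using has_vector_derivative_transform_within_open[OF d open_greaterThanLessThan x, of yd'] assms(3,4) x by simp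
  then show "AE x in lborel. x \<in> {a<..<b} \<longrightarrow> (yd' has_vector_derivative - g' x) (at x)"
    using assms(1) unfolding ode_on_def by (auto elim: eventually_mono)
qed

abbreviation glue :: "(real \<Rightarrow> complex) \<Rightarrow> (real \<Rightarrow> complex) \<Rightarrow> real \<Rightarrow> complex" where
  "glue f1 f2 \<equiv> \<lambda>x. if x < 0 then f1 x else f2 x"

lemma glue_tendsto:
  assumes f1: "continuous_on {-pi..0} f1" and f2: "continuous_on {0..pi} f2"
  shows "(glue f1 f2 \<longlongrightarrow> f1 (-pi)) (at_right (-pi))" "(glue f1 f2 \<longlongrightarrow> f1 0) (at_left 0)"
    "(glue f1 f2 \<longlongrightarrow> f2 0) (at_right 0)" "(glue f1 f2 \<longlongrightarrow> f2 pi) (at_left pi)"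
proof -
  have ev: "eventually (\<lambda>x. f1 x = glue f1 f2 x) (at_right (-pi))" "eventually (\<lambda>x. f1 x = glue f1 f2 x) (at_left 0)"
    "eventually (\<lambda>x. f2 x = glue f1 f2 x) (at_right 0)" "eventually (\<lambda>x. f2 x = glue f1 f2 x) (at_left pi)"
    using eventually_at_right_real[of "-pi" 0] eventually_at_left_real[of "-pi" 0]
      eventually_at_right_real[of 0 pi] eventually_at_left_real[of 0 pi]
    by (auto elim!: eventually_mono)
  show "(glue f1 f2 \<longlongrightarrow> f1 (-pi)) (at_right (-pi))" "(glue f1 f2 \<longlongrightarrow> f1 0) (at_left 0)"
    "(glue f1 f2 \<longlongrightarrow> f2 0) (at_right 0)" "(glue f1 f2 \<longlongrightarrow> f2 pi) (at_left pi)"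
    using ev continuous_on_Icc_tendsto[OF f1] continuous_on_Icc_tendsto[OF f2]
    by (auto intro: Lim_transform_eventually)
qed

lemma has_traces_glue:
  assumes y1: "ode_on_closed (-pi) 0 y1 yd1 g" and y2: "ode_on_closed 0 pi y2 yd2 g" and "inH g"
  shows "has_traces (glue y1 y2) g (y1 (-pi)) (yd1 (-pi)) (y1 0) (yd1 0) (y2 0) (yd2 0) (y2 pi) (yd2 pi)"
  unfolding has_traces_def
proof (intro conjI exI)
  note D1 = ode_on_closedD[OF y1] and D2 = ode_on_closedD[OF y2]
  show "inH (glue y1 y2)" unfolding inH_iff_L2 by (rule L2_piecewise[OF _ _ D1(3) D2(3)]) auto
  show "ode_on (-pi) 0 (glue y1 y2) (glue yd1 yd2) g" by (rule ode_on_cong[OF D1(5)]) auto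
  show "ode_on 0 pi (glue y1 y2) (glue yd1 yd2) g" by (rule ode_on_cong[OF D2(5)]) auto
  note glue_tendsto[OF D1(3) D2(3)] glue_tendsto[OF D1(4) D2(4)]
  then show "(glue y1 y2 \<longlongrightarrow> y1 (-pi)) (at_right (-pi))" "(glue yd1 yd2 \<longlongrightarrow> yd1 (-pi)) (at_right (-pi))"
    "(glue y1 y2 \<longlongrightarrow> y1 0) (at_left 0)" "(glue yd1 yd2 \<longlongrightarrow> yd1 0) (at_left 0)"
    "(glue y1 y2 \<longlongrightarrow> y2 0) (at_right 0)" "(glue yd1 yd2 \<longlongrightarrow> yd2 0) (at_right 0)"
    "(glue y1 y2 \<longlongrightarrow> y2 pi) (at_left pi)" "(glue yd1 yd2 \<longlongrightarrow> yd2 pi) (at_left pi)"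
    by blast+
qed fact

lemma piece_ok_ode_on_closed:
  assumes "ode_on_closed a b y yd g" "S \<subseteq> {a..b}" "\<And>x. x \<in> S \<Longrightarrow> y' x = y x" "\<And>x. x \<in> S \<Longrightarrow> yd' x = yd x"
  shows "piece_ok S y' yd'"
  unfolding piece_ok_def
proof (intro conjI ballI)
  show "AC_on S y'" "AC_on S yd'"
    using ode_on_closedD(1,2)[OF assms(1)] AC_on_subset[OF _ assms(2)] AC_on_cong assms(3,4) by metis+
  fix x assume x: "x \<in> S"
  then have "(y has_vector_derivative yd' x) (at x within {a..b})"
    using assms(1,2,4) unfolding ode_on_closed_def by auto
  then have "(y has_vector_derivative yd' x) (at x within S)"
    by (rule has_vector_derivative_within_subset[OF _ assms(2)])
  from has_vector_derivative_transform[OF x assms(3) this]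
  show "(y' has_vector_derivative yd' x) (at x within S)" by simp
qed

locale transmission =
  fixes \<alpha> \<beta> a1 a2 a3 a4 b1 b2 b3 b4 :: real
  assumes rho12: "a1 * b2 - a2 * b1 > 0" and rho34: "a3 * b4 - a4 * b3 > 0"
begin

abbreviation "\<rho>12 \<equiv> a1 * b2 - a2 * b1"
abbreviation "\<rho>34 \<equiv> a3 * b4 - a4 * b3"

abbreviation "A0 \<equiv> A_graph (\<lambda>_. 0) \<alpha> \<beta> a1 a2 a3 a4 b1 b2 b3 b4"

text \<open>Isolates the boundary conditions as a property of eight complex numbers, so that
  comparing \<open>A0\<close> with its adjoint ends in linear algebra on C^8.\<close>

definition bc :: "complex \<Rightarrow> complex \<Rightarrow> complex \<Rightarrow> complex \<Rightarrow> complex \<Rightarrow> complex \<Rightarrow> complex \<Rightarrow> complex \<Rightarrow> bool" where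
  "bc yl ydl ym ydm yp ydp yr ydr \<longleftrightarrow>
     of_real a1 * ydm + of_real a2 * ym + of_real a3 * ydp + of_real a4 * yp = 0 \<and>
     of_real b1 * ydm + of_real b2 * ym + of_real b3 * ydp + of_real b4 * yp = 0 \<and>
     of_real (cos \<alpha>) * yl + of_real (sin \<alpha>) * ydl = 0 \<and>
     of_real (cos \<beta>) * yr + of_real (sin \<beta>) * ydr = 0"

text \<open>The conditions use values at the outer endpoints but limits at 0. Continuity on the
  half-open pieces turns the values into limits as well, the form that Green's formula
  takes.\<close>

lemma A0_traces:
  assumes "A0 y g"
  obtains yl ydl ym ydm yp ydp yr ydr where
    "has_traces y g yl ydl ym ydm yp ydp yr ydr" "bc yl ydl ym ydm yp ydp yr ydr"
proof -
  obtain yd ym yp ydm ydp where H: "inH y" "inH g" "piece_ok {-pi..<0} y yd" "piece_ok {0<..pi} y yd"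
    and L: "(y \<longlongrightarrow> ym) (at_left 0)" "(y \<longlongrightarrow> yp) (at_right 0)" "(yd \<longlongrightarrow> ydm) (at_left 0)" "(yd \<longlongrightarrow> ydp) (at_right 0)"
    and ae: "AE x in lborel. x \<in> {-pi<..<0} \<union> {0<..<pi} \<longrightarrow>
            (yd has_vector_derivative (complex_of_real 0 * y x - g x)) (at x)"
    and B: "of_real a1 * Lim (at_left 0) yd + of_real a2 * Lim (at_left 0) y
          + of_real a3 * Lim (at_right 0) yd + of_real a4 * Lim (at_right 0) y = 0"
        "of_real b1 * Lim (at_left 0) yd + of_real b2 * Lim (at_left 0) y
          + of_real b3 * Lim (at_right 0) yd + of_real b4 * Lim (at_right 0) y = 0"
        "of_real (cos \<alpha>) * y (-pi) + of_real (sin \<alpha>) * yd (-pi) = 0"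
        "of_real (cos \<beta>) * y pi + of_real (sin \<beta>) * yd pi = 0"
    using assms unfolding A_graph_def by blast
  have lim: "Lim (at_left 0) y = ym" "Lim (at_right 0) y = yp" "Lim (at_left 0) yd = ydm" "Lim (at_right 0) yd = ydp"
    using L by (auto intro!: tendsto_Lim)
  have "AE x in lborel. x \<in> {-pi<..<0} \<longrightarrow> (yd has_vector_derivative - g x) (at x)"
    "AE x in lborel. x \<in> {0<..<pi} \<longrightarrow> (yd has_vector_derivative - g x) (at x)"
    using ae by (eventually_elim, simp)+
  then have ode: "ode_on (-pi) 0 y yd g" "ode_on 0 pi y yd g"
    by (intro ode_on_piece_ok[OF H(3)] ode_on_piece_ok[OF H(4)]; auto)+
  have AC: "AC_on {-pi..<0} y" "AC_on {-pi..<0} yd" "AC_on {0<..pi} y" "AC_on {0<..pi} yd"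
    using H(3,4) by (auto simp: piece_ok_def)
  \<comment> \<open>Closed subintervals that reach the outer endpoints and stay away from 0; -1 and
    1 are arbitrary inner points.\<close>
  have sub: "{-pi..-1} \<subseteq> {-pi..<0}" "{1..pi} \<subseteq> {0<..pi}" "-pi < -1" "1 < pi"
    using pi_gt3 by auto
  have ends: "(y \<longlongrightarrow> y (-pi)) (at_right (-pi))" "(yd \<longlongrightarrow> yd (-pi)) (at_right (-pi))"
     "(y \<longlongrightarrow> y pi) (at_left pi)" "(yd \<longlongrightarrow> yd pi) (at_left pi)"
    using AC_on_tendsto(1)[OF AC(1) sub(1,3)] AC_on_tendsto(1)[OF AC(2) sub(1,3)]
      AC_on_tendsto(2)[OF AC(3) sub(2,4)] AC_on_tendsto(2)[OF AC(4) sub(2,4)] by auto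
  show thesis
  proof
    show "has_traces y g (y (-pi)) (yd (-pi)) ym ydm yp ydp (y pi) (yd pi)"
      unfolding has_traces_def using H(1,2) ode L ends by blast
    show "bc (y (-pi)) (yd (-pi)) ym ydm yp ydp (y pi) (yd pi)"
      using B unfolding bc_def lim by simp
  qed
qed

lemma A0_glue:
  assumes y1: "ode_on_closed (-pi) 0 y1 yd1 g" and y2: "ode_on_closed 0 pi y2 yd2 g" and "inH g"
    and bc: "bc (y1 (-pi)) (yd1 (-pi)) (y1 0) (yd1 0) (y2 0) (yd2 0) (y2 pi) (yd2 pi)"
  shows "A0 (glue y1 y2) g"
  unfolding A_graph_def
proof (intro conjI exI)
  note D1 = ode_on_closedD[OF y1] and D2 = ode_on_closedD[OF y2]
  show "inH (glue y1 y2)" using has_traces_glue[OF assms(1-3)] by (simp add: has_traces_def)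
  show "inH g" by (rule assms(3))
  show "piece_ok {-pi..<0} (glue y1 y2) (glue yd1 yd2)" by (rule piece_ok_ode_on_closed[OF y1]) auto
  show "piece_ok {0<..pi} (glue y1 y2) (glue yd1 yd2)" by (rule piece_ok_ode_on_closed[OF y2]) auto
  note T = glue_tendsto[OF D1(3) D2(3)] glue_tendsto[OF D1(4) D2(4)]
  show "(glue y1 y2 \<longlongrightarrow> y1 0) (at_left 0)" "(glue yd1 yd2 \<longlongrightarrow> yd1 0) (at_left 0)"
    "(glue y1 y2 \<longlongrightarrow> y2 0) (at_right 0)" "(glue yd1 yd2 \<longlongrightarrow> yd2 0) (at_right 0)"
    using T by blast+
  have lim: "Lim (at_left 0) (glue y1 y2) = y1 0" "Lim (at_left 0) (glue yd1 yd2) = yd1 0"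
    "Lim (at_right 0) (glue y1 y2) = y2 0" "Lim (at_right 0) (glue yd1 yd2) = yd2 0"
    using T by (auto intro!: tendsto_Lim)
  have "ode_on (-pi) 0 (glue y1 y2) (glue yd1 yd2) g" "ode_on 0 pi (glue y1 y2) (glue yd1 yd2) g"
    using ode_on_cong[OF D1(5), of "glue y1 y2" "glue yd1 yd2" g]
      ode_on_cong[OF D2(5), of "glue y1 y2" "glue yd1 yd2" g] by simp_all
  then have ae1: "AE x in lborel. x \<in> {-pi<..<0} \<longrightarrow> (glue yd1 yd2 has_vector_derivative - g x) (at x)"
    and ae2: "AE x in lborel. x \<in> {0<..<pi} \<longrightarrow> (glue yd1 yd2 has_vector_derivative - g x) (at x)"
    unfolding ode_on_def by blast+
  show "AE x in lborel. x \<in> {-pi<..<0} \<union> {0<..<pi} \<longrightarrow>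
      (glue yd1 yd2 has_vector_derivative complex_of_real 0 * glue y1 y2 x - g x) (at x)"
    using ae1 ae2 by eventually_elim auto
  show "of_real a1 * Lim (at_left 0) (glue yd1 yd2) + of_real a2 * Lim (at_left 0) (glue y1 y2)
      + of_real a3 * Lim (at_right 0) (glue yd1 yd2) + of_real a4 * Lim (at_right 0) (glue y1 y2) = 0"
    "of_real b1 * Lim (at_left 0) (glue yd1 yd2) + of_real b2 * Lim (at_left 0) (glue y1 y2)
      + of_real b3 * Lim (at_right 0) (glue yd1 yd2) + of_real b4 * Lim (at_right 0) (glue y1 y2) = 0"
    "of_real (cos \<alpha>) * glue y1 y2 (-pi) + of_real (sin \<alpha>) * glue yd1 yd2 (-pi) = 0"
    "of_real (cos \<beta>) * glue y1 y2 pi + of_real (sin \<beta>) * glue yd1 yd2 pi = 0"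
    using bc unfolding bc_def lim by simp_all
qed

end

section \<open>Symmetry and the adjoint of the free operator\<close>

lemma cnj_linear_zero:
  assumes "of_real c * z + of_real s * zd = (0::complex)"
  shows "of_real c * cnj z + of_real s * cnj zd = 0"
  using arg_cong[OF assms, of cnj] by simp

text \<open>The data of y and the conjugated data of z are both annihilated by the real vector (cos
  t, sin t), so their determinant, the bracket, vanishes. The identity cos^2 + sin^2 = 1 tells
  \<open>algebra\<close> that this vector is non-zero.\<close>

lemma wronskian_robin:
  assumes y: "of_real (cos t) * y + of_real (sin t) * yd = 0" and z: "of_real (cos t) * z + of_real (sin t) * zd = 0"
  shows "wronskian y yd z zd = 0"
proof -
  have "(of_real (cos t))\<^sup>2 + (of_real (sin t))\<^sup>2 = complex_of_real ((cos t)\<^sup>2 + (sin t)\<^sup>2)"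
    by (simp only: of_real_add of_real_power)
  also have "\<dots> = 1" by simp
  finally show ?thesis
    using y cnj_linear_zero[OF z] unfolding wronskian_def by algebra
qed

lemma set_lebesgue_integral_cong_AE_Icc:
  fixes f g :: "real \<Rightarrow> complex"
  assumes "set_integrable lborel {a..b} f" "set_integrable lborel {a..b} g"
    and "AE x in lborel. x \<in> {a..b} \<longrightarrow> f x = g x"
  shows "(LINT x:{a..b}|lborel. f x) = (LINT x:{a..b}|lborel. g x)"
  unfolding set_lebesgue_integral_def
proof (rule integral_cong_AE)
  show "AE x in lborel. indicat_real {a..b} x *\<^sub>R f x = indicat_real {a..b} x *\<^sub>R g x"
    using assms(3) by eventually_elim (auto split: split_indicator)
qed (use assms(1,2) in \<open>auto simp: set_integrable_def\<close>)

lemma ipH_cong: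
  assumes "inH f" "inH g" "inH f'" "inH g'" "eqH f f'" "eqH g g'"
  shows "ipH r1 r2 f g = ipH r1 r2 f' g'"
proof -
  have "AE x in lborel. x \<in> {u..v} \<longrightarrow> f x * cnj (g x) = f' x * cnj (g' x)" if "{u..v} \<subseteq> {-pi..pi}" for u v
    using assms(5,6) unfolding eqH_def by eventually_elim (use that in auto)
  then show ?thesis
    unfolding ipH_def using assms(1-4)
    by (intro arg_cong2[where f = "(+)"] arg_cong2[where f = "(*)"] refl set_lebesgue_integral_cong_AE_Icc
        L2_mult_cnj_integrable inH_L2) auto
qed

lemma ipH_diff_right:
  assumes "inH f" "inH g" "inH h"
  shows "ipH r1 r2 f (\<lambda>x. g x - h x) = ipH r1 r2 f g - ipH r1 r2 f h"
proof -
  have "(LINT x:{a..b}|lborel. f x * cnj (g x - h x))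
      = (LINT x:{a..b}|lborel. f x * cnj (g x)) - (LINT x:{a..b}|lborel. f x * cnj (h x))"
    if "L2 a b f" "L2 a b g" "L2 a b h" for a b
    using set_integral_diff(2)[OF L2_mult_cnj_integrable[OF that(1,2)] L2_mult_cnj_integrable[OF that(1,3)]]
    by (simp add: right_diff_distrib)
  from this[OF inH_L2(1)[OF assms(1)] inH_L2(1)[OF assms(2)] inH_L2(1)[OF assms(3)]]
    this[OF inH_L2(2)[OF assms(1)] inH_L2(2)[OF assms(2)] inH_L2(2)[OF assms(3)]]
  show ?thesis unfolding ipH_def by (simp only: right_diff_distrib) simp
qed

lemma ipH_self:
  "ipH r1 r2 f f = of_real (r1 * (LINT x:{-pi..0}|lborel. (cmod (f x))\<^sup>2) + r2 * (LINT x:{0..pi}|lborel. (cmod (f x))\<^sup>2))"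
  unfolding ipH_def by (simp add: complex_norm_square[symmetric] set_integral_complex_of_real del: of_real_power)

lemma ipH_self_eq_0D:
  assumes "inH f" "r1 > 0" "r2 > 0" "ipH r1 r2 f f = 0"
  shows "AE x in lborel. x \<in> {-pi..pi} \<longrightarrow> f x = 0"
proof -
  have L2: "L2 (-pi) 0 f" "L2 0 pi f" using assms(1) by (rule inH_L2)+
  have nonneg: "(LINT x:{a..b}|lborel. (cmod (f x))\<^sup>2) \<ge> 0" for a b
    unfolding set_lebesgue_integral_def by (rule Bochner_Integration.integral_nonneg) auto
  have zero: "AE x in lborel. x \<in> {a..b} \<longrightarrow> f x = 0"
    if "L2 a b f" "(LINT x:{a..b}|lborel. (cmod (f x))\<^sup>2) = 0" for a b
  proof -
    have "AE x in lborel. indicat_real {a..b} x *\<^sub>R (cmod (f x))\<^sup>2 = 0"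
      using that unfolding L2_def set_lebesgue_integral_def set_integrable_def
      by (subst integral_nonneg_eq_0_iff_AE[symmetric]) auto
    then show ?thesis by eventually_elim (auto split: split_indicator_asm)
  qed
  have "r1 * (LINT x:{-pi..0}|lborel. (cmod (f x))\<^sup>2) + r2 * (LINT x:{0..pi}|lborel. (cmod (f x))\<^sup>2) = 0"
    using assms(4) unfolding ipH_self of_real_eq_0_iff .
  then have "(LINT x:{-pi..0}|lborel. (cmod (f x))\<^sup>2) = 0" "(LINT x:{0..pi}|lborel. (cmod (f x))\<^sup>2) = 0"
    using assms(2,3) nonneg[of "-pi" 0] nonneg[of 0 pi]
    by (simp_all add: add_nonneg_eq_0_iff)
  then have "AE x in lborel. x \<in> {-pi..0} \<longrightarrow> f x = 0" "AE x in lborel. x \<in> {0..pi} \<longrightarrow> f x = 0"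
    using zero L2 by auto
  then show ?thesis by eventually_elim (auto simp: not_le)
qed

lemma inH_glue:
  assumes "continuous_on {-pi..0} f1" "continuous_on {0..pi} f2"
  shows "inH (glue f1 f2)"
  unfolding inH_iff_L2 by (rule L2_piecewise[OF _ _ assms]) auto

lemma inH_diff: "inH f \<Longrightarrow> inH g \<Longrightarrow> inH (\<lambda>x. f x - g x)"
  unfolding inH_iff_L2 by (rule L2_diff)

context transmission
begin

text \<open>The boundary term of the weighted Green formula, a skew-Hermitian form on C^8. By
  \<open>boundary_form_bc\<close> and \<open>bc_if_boundary_form_zero\<close>, \<open>bc\<close> is
  a Lagrangian subspace for it: the finite-dimensional content of self-adjointness.\<close>

definition boundary_form :: "complex \<Rightarrow> complex \<Rightarrow> complex \<Rightarrow> complex \<Rightarrow> complex \<Rightarrow> complex \<Rightarrow> complex \<Rightarrow> complex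
    \<Rightarrow> complex \<Rightarrow> complex \<Rightarrow> complex \<Rightarrow> complex \<Rightarrow> complex \<Rightarrow> complex \<Rightarrow> complex \<Rightarrow> complex \<Rightarrow> complex" where
  "boundary_form yl ydl ym ydm yp ydp yr ydr zl zdl zm zdm zp zdp zr zdr =
     of_real \<rho>12 * (wronskian ym ydm zm zdm - wronskian yl ydl zl zdl)
   + of_real \<rho>34 * (wronskian yr ydr zr zdr - wronskian yp ydp zp zdp)"

text \<open>Let M have rows (a1, a2), (b1, b2) and N rows (a3, a4), (b3, b4). The transmission
  conditions read M (ydm, ym) = -N (ydp, yp), and likewise for the conjugated data of z, as the
  coefficients are real. Up to sign the bracket is a 2x2 determinant, so it is scaled by det M =
  \<open>\<rho>12\<close> on the left and by det N = \<open>\<rho>34\<close> on the right; the minus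
  sign disappears in even dimension.\<close>

lemma boundary_form_bc:
  assumes y: "bc yl ydl ym ydm yp ydp yr ydr" and z: "bc zl zdl zm zdm zp zdp zr zdr"
  shows "boundary_form yl ydl ym ydm yp ydp yr ydr zl zdl zm zdm zp zdp zr zdr = 0"
proof -
  have ends: "wronskian yl ydl zl zdl = 0" "wronskian yr ydr zr zdr = 0"
    using y z wronskian_robin unfolding bc_def by blast+
  have y': "of_real a1 * ydm + of_real a2 * ym + of_real a3 * ydp + of_real a4 * yp = 0"
     "of_real b1 * ydm + of_real b2 * ym + of_real b3 * ydp + of_real b4 * yp = 0"
    using y unfolding bc_def by blast+
  have "cnj (of_real a1 * zdm + of_real a2 * zm + of_real a3 * zdp + of_real a4 * zp) = 0"
     "cnj (of_real b1 * zdm + of_real b2 * zm + of_real b3 * zdp + of_real b4 * zp) = 0"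
    using z unfolding bc_def by simp_all
  then have z': "of_real a1 * cnj zdm + of_real a2 * cnj zm + of_real a3 * cnj zdp + of_real a4 * cnj zp = 0"
     "of_real b1 * cnj zdm + of_real b2 * cnj zm + of_real b3 * cnj zdp + of_real b4 * cnj zp = 0"
    by simp_all
  have "of_real \<rho>12 * wronskian ym ydm zm zdm = of_real \<rho>34 * wronskian yp ydp zp zdp"
    using y' z' unfolding wronskian_def of_real_diff of_real_mult by algebra
  with ends show ?thesis unfolding boundary_form_def by simp
qed

text \<open>The space of boundary data satisfying the boundary conditions is its own annihilator: each of the
  four test vectors below isolates one boundary condition.\<close>

lemma bc_if_boundary_form_zero:
  assumes H: "\<And>yl ydl ym ydm yp ydp yr ydr. bc yl ydl ym ydm yp ydp yr ydr
      \<Longrightarrow> boundary_form yl ydl ym ydm yp ydp yr ydr zl zdl zm zdm zp zdp zr zdr = 0"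
  shows "bc zl zdl zm zdm zp zdp zr zdr"
proof -
  have rho: "complex_of_real \<rho>12 \<noteq> 0" "complex_of_real \<rho>34 \<noteq> 0"
    using rho12 rho34 by (simp_all only: of_real_eq_0_iff)
  have "boundary_form (of_real (sin \<alpha>)) (- of_real (cos \<alpha>)) 0 0 0 0 0 0 zl zdl zm zdm zp zdp zr zdr = 0"
    by (rule H) (simp add: bc_def)
  then have "of_real \<rho>12 * (of_real (sin \<alpha>) * cnj zdl + of_real (cos \<alpha>) * cnj zl) = 0"
    unfolding boundary_form_def wronskian_def by algebra
  with rho have "of_real (sin \<alpha>) * cnj zdl + of_real (cos \<alpha>) * cnj zl = 0"
    by (metis mult_eq_0_iff)
  from arg_cong[OF this, of cnj] have 1: "of_real (cos \<alpha>) * zl + of_real (sin \<alpha>) * zdl = 0" by (simp add: add.commute)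
  have "boundary_form 0 0 0 0 0 0 (of_real (sin \<beta>)) (- of_real (cos \<beta>)) zl zdl zm zdm zp zdp zr zdr = 0"
    by (rule H) (simp add: bc_def)
  then have "of_real \<rho>34 * (of_real (sin \<beta>) * cnj zdr + of_real (cos \<beta>) * cnj zr) = 0"
    unfolding boundary_form_def wronskian_def by algebra
  with rho have "of_real (sin \<beta>) * cnj zdr + of_real (cos \<beta>) * cnj zr = 0"
    by (metis mult_eq_0_iff)
  from arg_cong[OF this, of cnj] have 2: "of_real (cos \<beta>) * zr + of_real (sin \<beta>) * zdr = 0" by (simp add: add.commute)
  have "boundary_form 0 0 (- of_real (\<rho>34 * b1)) (of_real (\<rho>34 * b2)) (of_real (\<rho>12 * b3)) (- of_real (\<rho>12 * b4)) 0 0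
      zl zdl zm zdm zp zdp zr zdr = 0"
    by (rule H) (simp add: bc_def algebra_simps)
  then have "of_real \<rho>12 * of_real \<rho>34 * (of_real b1 * cnj zdm + of_real b2 * cnj zm + of_real b3 * cnj zdp + of_real b4 * cnj zp) = 0"
    unfolding boundary_form_def wronskian_def of_real_mult of_real_diff by algebra
  with rho have "of_real b1 * cnj zdm + of_real b2 * cnj zm + of_real b3 * cnj zdp + of_real b4 * cnj zp = 0"
    by (metis mult_eq_0_iff)
  from arg_cong[OF this, of cnj] have 3: "of_real b1 * zdm + of_real b2 * zm + of_real b3 * zdp + of_real b4 * zp = 0" by simp
  have "boundary_form 0 0 (- of_real (\<rho>34 * a1)) (of_real (\<rho>34 * a2)) (of_real (\<rho>12 * a3)) (- of_real (\<rho>12 * a4)) 0 0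
      zl zdl zm zdm zp zdp zr zdr = 0"
    by (rule H) (simp add: bc_def algebra_simps)
  then have "of_real \<rho>12 * of_real \<rho>34 * (of_real a1 * cnj zdm + of_real a2 * cnj zm + of_real a3 * cnj zdp + of_real a4 * cnj zp) = 0"
    unfolding boundary_form_def wronskian_def of_real_mult of_real_diff by algebra
  with rho have "of_real a1 * cnj zdm + of_real a2 * cnj zm + of_real a3 * cnj zdp + of_real a4 * cnj zp = 0"
    by (metis mult_eq_0_iff)
  from arg_cong[OF this, of cnj] have 4: "of_real a1 * zdm + of_real a2 * zm + of_real a3 * zdp + of_real a4 * zp = 0" by simp
  from 1 2 3 4 show ?thesis by (simp add: bc_def)
qed

lemma A0_green:
  assumes "has_traces y g yl ydl ym ydm yp ydp yr ydr" "has_traces z w zl zdl zm zdm zp zdp zr zdr"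
  shows "ipH \<rho>12 \<rho>34 g z = ipH \<rho>12 \<rho>34 y w + boundary_form yl ydl ym ydm yp ydp yr ydr zl zdl zm zdm zp zdp zr zdr"
  unfolding ipH_green[OF assms] boundary_form_def by (simp only: add.assoc)

lemma A0_symmetric: "A0 y g \<Longrightarrow> A0 z w \<Longrightarrow> ipH \<rho>12 \<rho>34 g z = ipH \<rho>12 \<rho>34 y w"
  using A0_green boundary_form_bc by (elim A0_traces) simp

text \<open>Every admissible data vector occurs in the domain, so an identity tested on the domain
  becomes one for all vectors satisfying \<open>bc\<close>.\<close>

lemma A0_realizes_bc:
  assumes "bc yl ydl ym ydm yp ydp yr ydr"
  obtains y g where "A0 y g" "has_traces y g yl ydl ym ydm yp ydp yr ydr"
proof -
  obtain y1 yd1 g1 where 1: "ode_on_closed (-pi) 0 y1 yd1 g1" "continuous_on {-pi..0} g1"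
    "y1 (-pi) = yl" "yd1 (-pi) = ydl" "y1 0 = ym" "yd1 0 = ydm"
    using hermite_interpolation[of "-pi" 0] by (metis neg_less_0_iff_less pi_gt_zero)
  obtain y2 yd2 g2 where 2: "ode_on_closed 0 pi y2 yd2 g2" "continuous_on {0..pi} g2"
    "y2 0 = yp" "yd2 0 = ydp" "y2 pi = yr" "yd2 pi = ydr"
    using hermite_interpolation[of 0 pi] by (metis pi_gt_zero)
  have ode: "ode_on_closed (-pi) 0 y1 yd1 (glue g1 g2)" "ode_on_closed 0 pi y2 yd2 (glue g1 g2)"
    by (auto intro: ode_on_closed_cong[OF 1(1)] ode_on_closed_cong[OF 2(1)])
  have g: "inH (glue g1 g2)" by (rule inH_glue[OF 1(2) 2(2)])
  show thesis
    using that[OF A0_glue[OF ode g]] has_traces_glue[OF ode g] assms 1(3-) 2(3-) by simp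
qed

lemma A0_adjoint:
  assumes z: "inH z" and w: "inH w" and H: "\<And>y g. A0 y g \<Longrightarrow> ipH \<rho>12 \<rho>34 g z = ipH \<rho>12 \<rho>34 y w"
  obtains u where "A0 u w" "eqH u z"
proof -
  have pi: "-pi < 0" "0 < pi" by simp_all
  obtain u1 ud1 where u1: "ode_on_closed (-pi) 0 u1 ud1 w" using ode_exists[OF inH_L2(1)[OF w] pi(1)] .
  obtain u2 ud2 where u2: "ode_on_closed 0 pi u2 ud2 w" using ode_exists[OF inH_L2(2)[OF w] pi(2)] .
  define e where "e x = z x - glue u1 u2 x" for x
  have e: "inH e" unfolding e_def
    by (intro inH_diff z inH_glue ode_on_closedD(3)[OF u1] ode_on_closedD(3)[OF u2])
  obtain c0 c1 where c: "(LINT x:{-pi..0}|lborel. (e x - (c0 + c1 * of_real x)) * cnj 1) = 0"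
    "(LINT x:{-pi..0}|lborel. (e x - (c0 + c1 * of_real x)) * cnj (of_real x)) = 0"
    using affine_part_exists[OF inH_L2(1)[OF e] pi(1)] .
  obtain d0 d1 where d: "(LINT x:{0..pi}|lborel. (e x - (d0 + d1 * of_real x)) * cnj 1) = 0"
    "(LINT x:{0..pi}|lborel. (e x - (d0 + d1 * of_real x)) * cnj (of_real x)) = 0"
    using affine_part_exists[OF inH_L2(2)[OF e] pi(2)] .
  have lin: "L2 a b (\<lambda>x. c + c' * of_real x)" for a b c c' by (intro L2_continuous continuous_intros)
  \<comment> \<open>Moving the affine parts of \<open>e\<close> into the solution leaves the
    orthogonal remainder as \<phi> on each piece.\<close>
  define U1 U2 where "U1 x = u1 x + (c0 + c1 * of_real x)" and "U2 x = u2 x + (d0 + d1 * of_real x)" for x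
  define Ud1 Ud2 where "Ud1 x = c1 + ud1 x" and "Ud2 x = d1 + ud2 x" for x
  have U: "ode_on_closed (-pi) 0 U1 Ud1 w" "ode_on_closed 0 pi U2 Ud2 w"
    unfolding U1_def U2_def Ud1_def Ud2_def by (intro ode_on_closed_add_affine u1 u2)+
  define u where "u = glue U1 U2"
  note u_traces = has_traces_glue[OF U w, folded u_def]
  have u: "inH u" using u_traces by (simp add: has_traces_def)
  define \<phi> where "\<phi> x = z x - u x" for x
  have \<phi>: "inH \<phi>" unfolding \<phi>_def by (intro inH_diff z u)
  have \<phi>1: "\<phi> x = e x - (c0 + c1 * of_real x)" if "x < 0" for x
    using that by (simp add: \<phi>_def u_def e_def U1_def)
  have \<phi>2: "\<phi> x = e x - (d0 + d1 * of_real x)" if "x \<ge> 0" for x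
    using that by (simp add: \<phi>_def u_def e_def U2_def)
  \<comment> \<open>At the shared endpoint 0, \<open>glue\<close> takes the right branch. The
    integrands on the left piece therefore agree only almost everywhere, those on the right piece
    everywhere.\<close>
  have not0: "AE x in lborel. x \<noteq> (0::real)" by (rule AE_lborel_singleton)
  have orth1: "(LINT x:{-pi..0}|lborel. \<phi> x * cnj 1) = 0" "(LINT x:{-pi..0}|lborel. \<phi> x * cnj (of_real x)) = 0"
  proof -
    have "(LINT x:{-pi..0}|lborel. \<phi> x * cnj (h x)) = (LINT x:{-pi..0}|lborel. (e x - (c0 + c1 * of_real x)) * cnj (h x))"
      if "continuous_on {-pi..0} h" for h
      using not0 \<phi>1 by (intro set_lebesgue_integral_cong_AE_Icc L2_mult_cnj_integrable inH_L2(1)[OF \<phi>]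
          L2_diff[OF inH_L2(1)[OF e] lin] L2_continuous[OF that]) (auto elim!: eventually_mono)
    from this[of "\<lambda>_. 1"] this[of of_real] c show "(LINT x:{-pi..0}|lborel. \<phi> x * cnj 1) = 0"
      "(LINT x:{-pi..0}|lborel. \<phi> x * cnj (of_real x)) = 0" by (simp_all add: continuous_on_of_real_id)
  qed
  have orth2: "(LINT x:{0..pi}|lborel. \<phi> x * cnj 1) = 0" "(LINT x:{0..pi}|lborel. \<phi> x * cnj (of_real x)) = 0"
  proof -
    have "(LINT x:{0..pi}|lborel. \<phi> x * cnj (h x)) = (LINT x:{0..pi}|lborel. (e x - (d0 + d1 * of_real x)) * cnj (h x))" for h
      by (rule set_lebesgue_integral_cong) (simp_all add: \<phi>2)
    from this[of "\<lambda>_. 1"] this[of of_real] d show "(LINT x:{0..pi}|lborel. \<phi> x * cnj 1) = 0"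
      "(LINT x:{0..pi}|lborel. \<phi> x * cnj (of_real x)) = 0" by simp_all
  qed
  obtain v1 vd1 where v1: "ode_on_closed (-pi) 0 v1 vd1 \<phi>" "v1 (-pi) = 0" "vd1 (-pi) = 0" "v1 0 = 0" "vd1 0 = 0"
    using ode_zero_boundary[OF inH_L2(1)[OF \<phi>] pi(1) orth1] .
  obtain v2 vd2 where v2: "ode_on_closed 0 pi v2 vd2 \<phi>" "v2 0 = 0" "vd2 0 = 0" "v2 pi = 0" "vd2 pi = 0"
    using ode_zero_boundary[OF inH_L2(2)[OF \<phi>] pi(2) orth2] .
  have v: "A0 (glue v1 v2) \<phi>" by (rule A0_glue[OF v1(1) v2(1) \<phi>]) (simp add: v1 v2 bc_def)
  \<comment> \<open>All data of \<open>v\<close> are 0, so the boundary form vanishes although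
    \<open>u\<close> is not yet known to satisfy the boundary conditions. The hypothesis gives the
    same right-hand side with \<open>z\<close> in place of \<open>u\<close>; subtract.\<close>
  have "ipH \<rho>12 \<rho>34 \<phi> u = ipH \<rho>12 \<rho>34 (glue v1 v2) w"
    using A0_green[OF has_traces_glue[OF v1(1) v2(1) \<phi>] u_traces] v1 v2
    by (simp add: boundary_form_def wronskian_def)
  with H[OF v] have "ipH \<rho>12 \<rho>34 \<phi> \<phi> = 0"
    using ipH_diff_right[OF \<phi> z u, of \<rho>12 \<rho>34] by (simp add: \<phi>_def[abs_def])
  then have "AE x in lborel. x \<in> {-pi..pi} \<longrightarrow> \<phi> x = 0"
    using rho12 rho34 \<phi> by (intro ipH_self_eq_0D)
  then have uz: "eqH u z" unfolding eqH_def by eventually_elim (auto simp: \<phi>_def)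
  \<comment> \<open>As u = z almost everywhere, the hypothesis on \<open>z\<close> carries over to
    \<open>u\<close>, and Green's formula shows that the data of \<open>u\<close> annihilate every
    vector satisfying \<open>bc\<close>.\<close>
  have "bc (U1 (-pi)) (Ud1 (-pi)) (U1 0) (Ud1 0) (U2 0) (Ud2 0) (U2 pi) (Ud2 pi)"
  proof (rule bc_if_boundary_form_zero)
    fix yl ydl ym ydm yp ydp yr ydr assume "bc yl ydl ym ydm yp ydp yr ydr"
    then obtain y g where y: "A0 y g" "has_traces y g yl ydl ym ydm yp ydp yr ydr" by (rule A0_realizes_bc)
    have "inH g" using y(2) by (simp add: has_traces_def)
    have "ipH \<rho>12 \<rho>34 g u = ipH \<rho>12 \<rho>34 g z"
      using \<open>inH g\<close> u z uz by (intro ipH_cong) (auto simp: eqH_def)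
    with H[OF y(1)] A0_green[OF y(2) u_traces]
    show "boundary_form yl ydl ym ydm yp ydp yr ydr
        (U1 (-pi)) (Ud1 (-pi)) (U1 0) (Ud1 0) (U2 0) (Ud2 0) (U2 pi) (Ud2 pi) = 0" by simp
  qed
  then have "A0 u w" unfolding u_def by (rule A0_glue[OF U w])
  then show thesis using uz by (rule that)
qed

end

section \<open>Density of the domain\<close>

context transmission
begin

text \<open>Squared and unweighted, so that dominated convergence applies directly to the integrals;
  \<open>normH_le\<close> brings the weights back.\<close>

definition L2_approx :: "(real \<Rightarrow> complex) \<Rightarrow> bool" where
  "L2_approx f \<longleftrightarrow> (\<forall>\<epsilon>>0. \<exists>y g. A0 y g \<and> (LINT x:{-pi..pi}|lborel. (cmod (f x - y x))\<^sup>2) < \<epsilon>)"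

lemma A0_inH: "A0 y g \<Longrightarrow> inH y"
  by (simp add: A_graph_def)

text \<open>The closure step behind all four stages: cut-off polynomials, uniform approximation by
  polynomials, continuous approximation of bounded functions, and truncation.\<close>

lemma L2_approx_limit:
  assumes F: "\<And>n. L2_approx (F n)" "\<And>n. inH (F n)" and f: "inH f"
    and lim: "AE x in lborel. x \<in> {-pi..pi} \<longrightarrow> (\<lambda>n. F n x) \<longlonglongrightarrow> f x"
    and G: "set_integrable lborel {-pi..pi} G"
    and bound: "\<And>n x. x \<in> {-pi..pi} \<Longrightarrow> (cmod (f x - F n x))\<^sup>2 \<le> G x"
  shows "L2_approx f"
  unfolding L2_approx_def
proof (intro allI impI)
  fix \<epsilon> :: real assume "\<epsilon> > 0"
  have sq_int: "set_integrable lborel {-pi..pi} (\<lambda>x. (cmod (u x - v x))\<^sup>2)" if "inH u" "inH v" for u v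
    using L2_diff[of "-pi" pi u v] that by (simp add: inH_iff_L2 L2_def)
  have "(\<lambda>n. LINT x|lborel. indicat_real {-pi..pi} x *\<^sub>R (cmod (f x - F n x))\<^sup>2)
      \<longlonglongrightarrow> integral\<^sup>L lborel (\<lambda>_::real. 0::real)"
  proof (rule integral_dominated_convergence)
    show "integrable lborel (\<lambda>x. indicat_real {-pi..pi} x *\<^sub>R G x)" using G by (simp add: set_integrable_def)
    show "AE x in lborel. (\<lambda>n. indicat_real {-pi..pi} x *\<^sub>R (cmod (f x - F n x))\<^sup>2) \<longlonglongrightarrow> 0"
      using lim
    proof eventually_elim
      case (elim x)
      show ?case
      proof (cases "x \<in> {-pi..pi}")
        case True
        with elim have "(\<lambda>n. (cmod (f x - F n x))\<^sup>2) \<longlonglongrightarrow> (cmod (f x - f x))\<^sup>2" by (intro tendsto_intros) auto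
        with True show ?thesis by simp
      qed simp
    qed
    show "(\<lambda>x. indicat_real {-pi..pi} x *\<^sub>R (cmod (f x - F n x))\<^sup>2) \<in> borel_measurable lborel" for n
      using sq_int[OF f F(2)] unfolding set_integrable_def by (rule borel_measurable_integrable)
    show "AE x in lborel. norm (indicat_real {-pi..pi} x *\<^sub>R (cmod (f x - F n x))\<^sup>2) \<le> indicat_real {-pi..pi} x *\<^sub>R G x" for n
      using bound by (intro AE_I2) (auto split: split_indicator)
  qed simp
  then have "(\<lambda>n. LINT x:{-pi..pi}|lborel. (cmod (f x - F n x))\<^sup>2) \<longlonglongrightarrow> 0"
    unfolding set_lebesgue_integral_def by simp
  \<comment> \<open>By (s + t)^2 <= 2 s^2 + 2 t^2 each of the two errors is doubled, hence a quarter
    of \<epsilon> for each.\<close>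
  then have "eventually (\<lambda>n. (LINT x:{-pi..pi}|lborel. (cmod (f x - F n x))\<^sup>2) < \<epsilon> / 4) sequentially"
    using \<open>\<epsilon> > 0\<close> by (intro order_tendstoD(2)) auto
  then obtain n where n: "(LINT x:{-pi..pi}|lborel. (cmod (f x - F n x))\<^sup>2) < \<epsilon> / 4"
    by (auto dest: eventually_happens)
  have "\<epsilon> / 4 > 0" using \<open>\<epsilon> > 0\<close> by simp
  then obtain y g where y: "A0 y g" "(LINT x:{-pi..pi}|lborel. (cmod (F n x - y x))\<^sup>2) < \<epsilon> / 4"
    using F(1)[of n] unfolding L2_approx_def by blast
  have "(LINT x:{-pi..pi}|lborel. (cmod (f x - y x))\<^sup>2)
      \<le> (LINT x:{-pi..pi}|lborel. 2 * (cmod (f x - F n x))\<^sup>2 + 2 * (cmod (F n x - y x))\<^sup>2)"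
  proof (rule set_integral_mono)
    show "set_integrable lborel {-pi..pi} (\<lambda>x. (cmod (f x - y x))\<^sup>2)" by (rule sq_int[OF f A0_inH[OF y(1)]])
    show "set_integrable lborel {-pi..pi} (\<lambda>x. 2 * (cmod (f x - F n x))\<^sup>2 + 2 * (cmod (F n x - y x))\<^sup>2)"
      by (intro set_integral_add set_integrable_mult_right sq_int f F(2) A0_inH[OF y(1)])
    fix x
    have "cmod (f x - y x) \<le> cmod (f x - F n x) + cmod (F n x - y x)"
      using norm_triangle_ineq[of "f x - F n x" "F n x - y x"] by simp
    then have "(cmod (f x - y x))\<^sup>2 \<le> (cmod (f x - F n x) + cmod (F n x - y x))\<^sup>2" by (rule power_mono) simp
    also have "\<dots> \<le> 2 * (cmod (f x - F n x))\<^sup>2 + 2 * (cmod (F n x - y x))\<^sup>2"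
      using sum_squares_bound[of "cmod (f x - F n x)" "cmod (F n x - y x)"] by (simp add: power2_sum)
    finally show "(cmod (f x - y x))\<^sup>2 \<le> 2 * (cmod (f x - F n x))\<^sup>2 + 2 * (cmod (F n x - y x))\<^sup>2" .
  qed
  also have "\<dots> = 2 * (LINT x:{-pi..pi}|lborel. (cmod (f x - F n x))\<^sup>2) + 2 * (LINT x:{-pi..pi}|lborel. (cmod (F n x - y x))\<^sup>2)"
    by (subst set_integral_add(2)) (auto intro!: set_integrable_mult_right sq_int f F(2) A0_inH[OF y(1)])
  also have "\<dots> < \<epsilon>" using n y(2) by linarith
  finally show "\<exists>y g. A0 y g \<and> (LINT x:{-pi..pi}|lborel. (cmod (f x - y x))\<^sup>2) < \<epsilon>" using y(1) by blast
qed

section \<open>Polynomials cut off at the boundary points\<close>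

lemma L2_approx_A0:
  assumes "A0 y g"
  shows "L2_approx y"
proof -
  have "(LINT x:{-pi..pi}|lborel. (cmod (y x - y x))\<^sup>2) = 0" by (simp add: set_lebesgue_integral_def)
  then show ?thesis using assms unfolding L2_approx_def by metis
qed

text \<open>An even polynomial with zeros exactly at 0 and +-pi; the factor 4 / pi^4 normalizes its
  maximum, attained at x^2 = pi^2 / 2, to 1.\<close>

definition bump :: "real \<Rightarrow> real" where
  "bump x = 4 * x\<^sup>2 * (pi\<^sup>2 - x\<^sup>2) / pi ^ 4"

lemma bump_bounds: "x \<in> {-pi..pi} \<Longrightarrow> 0 \<le> bump x \<and> bump x \<le> 1"
proof -
  assume "x \<in> {-pi..pi}"
  then have "x\<^sup>2 \<le> pi\<^sup>2" by (intro abs_le_square_iff[THEN iffD1]) auto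
  \<comment> \<open>This square equals
    \<open>pi ^ 4 - 4 * x\<^sup>2 * (pi\<^sup>2 - x\<^sup>2)\<close>, which yields the upper
    bound.\<close>
  moreover have "0 \<le> (pi\<^sup>2 - 2 * x\<^sup>2)\<^sup>2" by simp
  then have "4 * x\<^sup>2 * (pi\<^sup>2 - x\<^sup>2) \<le> pi ^ 4"
    by (simp add: power2_diff power_mult_distrib algebra_simps flip: power_mult)
  ultimately show ?thesis unfolding bump_def by simp
qed

lemma bump_zero: "bump 0 = 0" "bump pi = 0" "bump (-pi) = 0"
  by (simp_all add: bump_def)

lemma bump_pos: "x \<in> {-pi..pi} \<Longrightarrow> x \<notin> {0, pi, -pi} \<Longrightarrow> bump x > 0"
proof -
  assume x: "x \<in> {-pi..pi}" "x \<notin> {0, pi, -pi}"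
  then have "\<bar>x\<bar> < \<bar>pi\<bar>" by auto
  then have "x\<^sup>2 < pi\<^sup>2" using power_strict_mono[of "\<bar>x\<bar>" "\<bar>pi\<bar>" 2] by simp
  with x show ?thesis by (simp add: bump_def)
qed

lemma polynomial_function_bump: "polynomial_function bump"
proof -
  have "polynomial_function (\<lambda>x. x * x :: real)"
    using polynomial_function_mult[OF polynomial_function_id polynomial_function_id] by simp
  then have "polynomial_function (\<lambda>x. (4 / pi ^ 4) *\<^sub>R ((x * x) *\<^sub>R (pi\<^sup>2 - x * x)))"
    by (intro polynomial_function_cmul polynomial_function_mult polynomial_function_diff polynomial_function_const)
  moreover have "(\<lambda>x. (4 / pi ^ 4) *\<^sub>R ((x * x) *\<^sub>R (pi\<^sup>2 - x * x))) = bump"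
    by (auto simp: bump_def fun_eq_iff power2_eq_square)
  ultimately show ?thesis by simp
qed

definition cutoff :: "nat \<Rightarrow> real \<Rightarrow> real" where
  "cutoff n x = 1 - (1 - (bump x)\<^sup>2) ^ n"

text \<open>\<open>cutoff n\<close> is a polynomial vanishing to second order at \<open>0\<close> and at \<open>\<plusminus>\<pi>\<close>, so multiplying by
  it turns any polynomial into an element of the domain.\<close>

lemma cutoff_bounds: "x \<in> {-pi..pi} \<Longrightarrow> 0 \<le> cutoff n x \<and> cutoff n x \<le> 1"
proof -
  assume "x \<in> {-pi..pi}"
  then have "(bump x)\<^sup>2 \<le> 1" using bump_bounds by (simp add: power_le_one)
  then show ?thesis by (simp add: cutoff_def power_le_one)
qed

lemma cutoff_tendsto: "x \<in> {-pi..pi} \<Longrightarrow> x \<notin> {0, pi, -pi} \<Longrightarrow> (\<lambda>n. cutoff n x) \<longlonglongrightarrow> 1"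
proof -
  assume x: "x \<in> {-pi..pi}" "x \<notin> {0, pi, -pi}"
  then have "0 < (bump x)\<^sup>2" "(bump x)\<^sup>2 \<le> 1" using bump_pos[OF x] bump_bounds[OF x(1)] by (auto simp: power_le_one)
  then have "(\<lambda>n. (1 - (bump x)\<^sup>2) ^ n) \<longlonglongrightarrow> 0" by (intro LIMSEQ_realpow_zero) linarith+
  then have "(\<lambda>n. 1 - (1 - (bump x)\<^sup>2) ^ n) \<longlonglongrightarrow> 1 - 0" by (rule tendsto_diff[OF tendsto_const])
  then show ?thesis by (simp add: cutoff_def)
qed

lemma polynomial_function_cutoff: "polynomial_function (cutoff n)"
proof -
  have "polynomial_function (\<lambda>x. bump x * bump x)"
    using polynomial_function_mult[OF polynomial_function_bump polynomial_function_bump] by simp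
  then have base: "polynomial_function (\<lambda>x. 1 - bump x * bump x)"
    by (intro polynomial_function_diff polynomial_function_const)
  have "polynomial_function (\<lambda>x. (1 - bump x * bump x) ^ k)" for k
  proof (induction k)
    case (Suc k)
    then show ?case using polynomial_function_mult[OF base Suc] by simp
  qed (simp add: polynomial_function_const)
  then have "polynomial_function (\<lambda>x. 1 - (1 - bump x * bump x) ^ n)"
    by (intro polynomial_function_diff polynomial_function_const)
  then show ?thesis by (simp add: cutoff_def[abs_def] power2_eq_square)
qed

lemma A0_cutoff:
  fixes p :: "real \<Rightarrow> complex"
  assumes p: "polynomial_function p"
  shows "\<exists>g. A0 (\<lambda>x. cutoff n x *\<^sub>R p x) g"
proof -
  define y where "y x = cutoff n x *\<^sub>R p x" for x
  have "polynomial_function y" unfolding y_def by (rule polynomial_function_mult[OF polynomial_function_cutoff p])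
  then obtain yd where yd: "polynomial_function yd" "\<And>x. (y has_vector_derivative yd x) (at x)"
    using has_vector_derivative_polynomial_function by blast
  obtain ydd where ydd: "polynomial_function ydd" "\<And>x. (yd has_vector_derivative ydd x) (at x)"
    using has_vector_derivative_polynomial_function[OF yd(1)] by blast
  obtain pd where pd: "\<And>x. (p has_vector_derivative pd x) (at x)"
    using has_vector_derivative_polynomial_function[OF p] by blast
  obtain bd where bd: "\<And>x. (bump has_real_derivative bd x) (at x)"
    using has_vector_derivative_polynomial_function[OF polynomial_function_bump]
    unfolding has_real_derivative_iff_has_vector_derivative by blast
  have zero: "y x = 0 \<and> yd x = 0" if "bump x = 0" for x
  proof -
    \<comment> \<open>The square inside \<open>cutoff\<close> puts a factor \<open>bump x\<close>
      into the derivative, so the derivative vanishes even at the simple zeros +-pi of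
      \<open>bump\<close>. For n = 0 the factor \<open>real n\<close> takes care of the truncated
      exponent.\<close>
    have "(cutoff n has_real_derivative - (real n * (1 - (bump x)\<^sup>2) ^ (n - 1) * - (2 * bump x * bd x))) (at x)"
      unfolding cutoff_def[abs_def] by (auto intro!: derivative_eq_intros bd simp: field_simps)
    then have "(cutoff n has_real_derivative 0) (at x)" using that by simp
    from has_vector_derivative_scaleR[OF this pd[of x]]
    have "(y has_vector_derivative cutoff n x *\<^sub>R pd x) (at x)" by (simp add: y_def[abs_def])
    moreover have "cutoff n x = 0" using that by (simp add: cutoff_def)
    ultimately have "(y has_vector_derivative 0) (at x)" by simp
    with \<open>cutoff n x = 0\<close> show ?thesis using vector_derivative_unique_at[OF yd(2)] by (auto simp: y_def)
  qed
  have cont: "continuous_on S ydd" for S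
    using continuous_on_polymonial_function[OF ydd(1)] by blast
  have "A0 (glue y y) (\<lambda>x. - ydd x)"
  proof (rule A0_glue)
    show "ode_on_closed (-pi) 0 y yd (\<lambda>x. - ydd x)" "ode_on_closed 0 pi y yd (\<lambda>x. - ydd x)"
      by (intro ode_on_closed_C2 yd(2) ydd(2) cont)+
    show "inH (\<lambda>x. - ydd x)" unfolding inH_iff_L2 by (intro L2_continuous continuous_intros cont)
    show "bc (y (-pi)) (yd (-pi)) (y 0) (yd 0) (y 0) (yd 0) (y pi) (yd pi)"
      using zero[OF bump_zero(1)] zero[OF bump_zero(2)] zero[OF bump_zero(3)] by (simp add: bc_def)
  qed
  then show ?thesis by (auto simp: y_def)
qed

lemma L2_approx_polynomial:
  fixes p :: "real \<Rightarrow> complex"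
  assumes p: "polynomial_function p"
  shows "L2_approx p"
proof (rule L2_approx_limit[where F = "\<lambda>n x. cutoff n x *\<^sub>R p x" and G = "\<lambda>x. (cmod (p x))\<^sup>2"])
  have cp: "continuous_on S p" for S using continuous_on_polymonial_function[OF p] by blast
  show "inH p" unfolding inH_iff_L2 by (rule L2_continuous[OF cp])
  show "L2_approx (\<lambda>x. cutoff n x *\<^sub>R p x)" "inH (\<lambda>x. cutoff n x *\<^sub>R p x)" for n
    using A0_cutoff[OF p] L2_approx_A0 A0_inH by blast+
  show "AE x in lborel. x \<in> {-pi..pi} \<longrightarrow> (\<lambda>n. cutoff n x *\<^sub>R p x) \<longlonglongrightarrow> p x"
    using AE_lborel_singleton[of 0] AE_lborel_singleton[of pi] AE_lborel_singleton[of "-pi"]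
  proof eventually_elim
    case (elim x)
    show ?case
    proof
      assume "x \<in> {-pi..pi}"
      with elim have "(\<lambda>n. cutoff n x) \<longlonglongrightarrow> 1" by (intro cutoff_tendsto) auto
      from tendsto_scaleR[OF this tendsto_const[of "p x"]] show "(\<lambda>n. cutoff n x *\<^sub>R p x) \<longlonglongrightarrow> p x" by simp
    qed
  qed
  show "set_integrable lborel {-pi..pi} (\<lambda>x. (cmod (p x))\<^sup>2)"
    using L2_continuous[OF cp] unfolding L2_def by blast
  fix n x assume "x \<in> {-pi..pi}"
  have "p x - cutoff n x *\<^sub>R p x = (1 - cutoff n x) *\<^sub>R p x" by (simp add: scaleR_diff_left)
  then have "cmod (p x - cutoff n x *\<^sub>R p x) = \<bar>1 - cutoff n x\<bar> * cmod (p x)" by simp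
  also have "\<dots> \<le> 1 * cmod (p x)" using cutoff_bounds[OF \<open>x \<in> {-pi..pi}\<close>, of n] by (intro mult_right_mono) auto
  finally show "(cmod (p x - cutoff n x *\<^sub>R p x))\<^sup>2 \<le> (cmod (p x))\<^sup>2" by (simp add: power_mono)
qed

lemma L2_approx_continuous:
  assumes f: "continuous_on {-pi..pi} f"
  shows "L2_approx f"
proof -
  have "\<exists>p. polynomial_function p \<and> (\<forall>x\<in>{-pi..pi}. cmod (f x - p x) < inverse (real (Suc n)))" for n
    by (rule Stone_Weierstrass_polynomial_function[OF compact_Icc f]) simp
  then obtain P where P: "\<And>n. polynomial_function (P n)"
    "\<And>n x. x \<in> {-pi..pi} \<Longrightarrow> cmod (f x - P n x) < inverse (real (Suc n))"
    by metis
  show ?thesis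
  \<comment> \<open>The errors are below \<open>inverse (real (Suc n))\<close>, hence at most 1.
    Writing this constant as a squared modulus makes its integrability an instance of
    \<open>L2_const\<close>.\<close>
  proof (rule L2_approx_limit[where F = P and G = "\<lambda>x. (cmod 1)\<^sup>2"])
    show "L2_approx (P n)" for n by (rule L2_approx_polynomial[OF P(1)])
    show "inH (P n)" for n
      unfolding inH_iff_L2 using continuous_on_polymonial_function[OF P(1)] by (intro L2_continuous) blast
    show "inH f" unfolding inH_iff_L2 by (rule L2_continuous[OF f])
    have "(\<lambda>n. P n x) \<longlonglongrightarrow> f x" if "x \<in> {-pi..pi}" for x
    proof (rule LIM_zero_cancel, rule Lim_null_comparison[OF _ LIMSEQ_inverse_real_of_nat])
      show "\<forall>\<^sub>F n in sequentially. cmod (P n x - f x) \<le> inverse (real (Suc n))"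
        using P(2)[OF that] by (intro always_eventually allI) (simp add: norm_minus_commute less_imp_le)
    qed
    then show "AE x in lborel. x \<in> {-pi..pi} \<longrightarrow> (\<lambda>n. P n x) \<longlonglongrightarrow> f x" by simp
    show "set_integrable lborel {-pi..pi} (\<lambda>x. (cmod 1)\<^sup>2)"
      using L2_const[of "-pi" pi 1] unfolding L2_def by blast
    fix n x assume x: "x \<in> {-pi..pi}"
    have "inverse (real (Suc n)) \<le> 1" by (simp add: inverse_le_1_iff)
    then have "cmod (f x - P n x) \<le> 1" using P(2)[OF x, of n] by linarith
    then show "(cmod (f x - P n x))\<^sup>2 \<le> (cmod 1)\<^sup>2" by (simp add: power_le_one)
  qed
qed

text \<open>A measurable function is almost everywhere a limit of continuous functions, but these
  need not be uniformly bounded. The nearest-point retraction \<open>P\<close> onto the disc of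
  radius B is continuous and fixes the values of f on the interval, so composing with it keeps the
  limit and bounds the error by 2 B.\<close>

lemma L2_approx_bounded:
  assumes f: "inH f" and B: "\<And>x. x \<in> {-pi..pi} \<Longrightarrow> cmod (f x) \<le> B"
  shows "L2_approx f"
proof -
  define h where "h x = indicat_real {-pi..pi} x *\<^sub>R f x" for x
  have "h \<in> borel_measurable lebesgue"
    using L2_measurable[of "-pi" pi f] f unfolding h_def inH_iff_L2 by (simp add: measurable_completion)
  then have "h measurable_on UNIV" by (rule lebesgue_measurable_imp_measurable_on) simp
  then obtain N g where "negligible N" and g: "\<And>n. continuous_on UNIV (g n)"
    and lim: "\<And>x. x \<notin> N \<Longrightarrow> (\<lambda>n. g n x) \<longlonglongrightarrow> h x"
    unfolding measurable_on_def by auto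
  have "AE x in lebesgue. x \<notin> N" using \<open>negligible N\<close> by (simp only: negligible_iff_null_sets AE_not_in)
  then have N: "AE x in lborel. x \<notin> N" by (simp add: AE_completion_iff)
  have "cmod (f 0) \<le> B" by (rule B) simp
  then have "B \<ge> 0" using norm_ge_zero[of "f 0"] by linarith
  define P where "P = closest_point (cball (0::complex) B)"
  have P: "continuous_on UNIV P" "\<And>z. cmod (P z) \<le> B" "\<And>z. cmod z \<le> B \<Longrightarrow> P z = z"
    unfolding P_def using continuous_on_closest_point[of "cball 0 B"] closest_point_in_set[of "cball 0 B"] \<open>B \<ge> 0\<close>
    by (auto simp: closest_point_self)
  have cont: "continuous_on {-pi..pi} (\<lambda>x. P (g n x))" for n
    using continuous_on_compose2[OF P(1) g subset_UNIV] continuous_on_subset by blast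
  show ?thesis
  proof (rule L2_approx_limit[where F = "\<lambda>n x. P (g n x)" and G = "\<lambda>x. (cmod (of_real (2 * B)))\<^sup>2"])
    show "L2_approx (\<lambda>x. P (g n x))" for n by (rule L2_approx_continuous[OF cont])
    show "inH (\<lambda>x. P (g n x))" for n unfolding inH_iff_L2 by (rule L2_continuous[OF cont])
    show "inH f" by fact
    show "AE x in lborel. x \<in> {-pi..pi} \<longrightarrow> (\<lambda>n. P (g n x)) \<longlonglongrightarrow> f x"
      using N
    proof eventually_elim
      case (elim x)
      show ?case
      proof
        assume x: "x \<in> {-pi..pi}"
        have "isCont P (h x)" using P(1) by (simp add: continuous_on_eq_continuous_at)
        then have "(\<lambda>n. P (g n x)) \<longlonglongrightarrow> P (h x)" using lim[OF elim] by (rule isCont_tendsto_compose)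
        then show "(\<lambda>n. P (g n x)) \<longlonglongrightarrow> f x" using x P(3)[OF B[OF x]] by (simp add: h_def)
      qed
    qed
    show "set_integrable lborel {-pi..pi} (\<lambda>x. (cmod (of_real (2 * B)))\<^sup>2)"
      using L2_const[of "-pi" pi "of_real (2 * B)"] unfolding L2_def by blast
    fix n x assume x: "x \<in> {-pi..pi}"
    have "cmod (f x - P (g n x)) \<le> 2 * B"
      using norm_triangle_ineq4[of "f x" "P (g n x)"] B[OF x] P(2)[of "g n x"] by linarith
    then show "(cmod (f x - P (g n x)))\<^sup>2 \<le> (cmod (of_real (2 * B)))\<^sup>2"
      using \<open>B \<ge> 0\<close> by (intro power_mono) auto
  qed
qed

text \<open>Truncate by modulus: at each point \<open>F n\<close> is eventually equal to f, and the
  error never exceeds |f|.\<close>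

lemma L2_approx_inH:
  assumes f: "inH f"
  shows "L2_approx f"
proof -
  define F where "F n x = (if cmod (f x) \<le> real n then f x else 0)" for n x
  have F: "inH (F n)" for n
    unfolding inH_iff_L2
  proof (rule L2_dominated[OF _ f[unfolded inH_iff_L2] f[unfolded inH_iff_L2] order_refl order_refl, of _ 1])
    have m: "(\<lambda>x. indicat_real {-pi..pi} x *\<^sub>R f x) \<in> borel_measurable lborel"
      using f unfolding inH_iff_L2 by (rule L2_measurable)
    have "(\<lambda>x. if cmod (indicat_real {-pi..pi} x *\<^sub>R f x) \<le> real n then indicat_real {-pi..pi} x *\<^sub>R f x else 0)
        \<in> borel_measurable lborel" using m by measurable
    moreover have "(\<lambda>x. if cmod (indicat_real {-pi..pi} x *\<^sub>R f x) \<le> real n then indicat_real {-pi..pi} x *\<^sub>R f x else 0)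
        = (\<lambda>x. indicat_real {-pi..pi} x *\<^sub>R F n x)"
      by (auto simp: F_def fun_eq_iff split: split_indicator)
    ultimately show "set_borel_measurable lborel {-pi..pi} (F n)" unfolding set_borel_measurable_def by simp
    show "AE x in lborel. x \<in> {-pi..pi} \<longrightarrow> cmod (F n x) \<le> 1 * (cmod (f x) + cmod (f x))"
      by (simp add: F_def)
  qed
  have approx: "L2_approx (F n)" for n by (rule L2_approx_bounded[OF F, of _ "real n"]) (simp add: F_def)
  have "(\<lambda>n. F n x) \<longlonglongrightarrow> f x" for x
  proof (rule tendsto_eventually)
    have "F n x = f x" if "n \<ge> nat \<lceil>cmod (f x)\<rceil>" for n using that by (simp add: F_def)
    then show "\<forall>\<^sub>F n in sequentially. F n x = f x" by (rule eventually_sequentiallyI)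
  qed
  then have lim: "AE x in lborel. x \<in> {-pi..pi} \<longrightarrow> (\<lambda>n. F n x) \<longlonglongrightarrow> f x" by simp
  have int: "set_integrable lborel {-pi..pi} (\<lambda>x. (cmod (f x))\<^sup>2)" using f unfolding inH_def by blast
  have bound: "(cmod (f x - F n x))\<^sup>2 \<le> (cmod (f x))\<^sup>2" for n x by (simp add: F_def)
  show ?thesis by (rule L2_approx_limit[OF approx F f lim int bound])
qed

end

section \<open>The operator with potential\<close>

lemma ipH_diff_left:
  assumes "inH f" "inH g" "inH h"
  shows "ipH r1 r2 (\<lambda>x. f x - g x) h = ipH r1 r2 f h - ipH r1 r2 g h"
proof -
  have "(LINT x:{a..b}|lborel. (f x - g x) * cnj (h x))
      = (LINT x:{a..b}|lborel. f x * cnj (h x)) - (LINT x:{a..b}|lborel. g x * cnj (h x))"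
    if "L2 a b f" "L2 a b g" "L2 a b h" for a b
    using set_integral_diff(2)[OF L2_mult_cnj_integrable[OF that(1,3)] L2_mult_cnj_integrable[OF that(2,3)]]
    by (simp add: left_diff_distrib)
  from this[OF inH_L2(1)[OF assms(1)] inH_L2(1)[OF assms(2)] inH_L2(1)[OF assms(3)]]
    this[OF inH_L2(2)[OF assms(1)] inH_L2(2)[OF assms(2)] inH_L2(2)[OF assms(3)]]
  show ?thesis unfolding ipH_def by (simp only: right_diff_distrib) simp
qed

lemma ipH_real_multiplier: "ipH r1 r2 (\<lambda>x. of_real (q x) * f x) g = ipH r1 r2 f (\<lambda>x. of_real (q x) * g x)"
  unfolding ipH_def by (simp add: ac_simps)

lemma normH_le:
  assumes h: "inH h" and r: "r1 > 0" "r2 > 0"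
  shows "normH r1 r2 h \<le> sqrt ((r1 + r2) * (LINT x:{-pi..pi}|lborel. (cmod (h x))\<^sup>2))"
proof -
  have int: "set_integrable lborel {-pi..pi} (\<lambda>x. (cmod (h x))\<^sup>2)" using h by (simp add: inH_def)
  have "(LINT x:{a..b}|lborel. (cmod (h x))\<^sup>2) \<le> (LINT x:{-pi..pi}|lborel. (cmod (h x))\<^sup>2)"
    if "{a..b} \<subseteq> {-pi..pi}" for a b
    unfolding set_lebesgue_integral_def
  proof (rule integral_mono)
    show "integrable lborel (\<lambda>x. indicat_real {a..b} x *\<^sub>R (cmod (h x))\<^sup>2)"
      using set_integrable_subset[OF int _ that] by (simp add: set_integrable_def)
    show "integrable lborel (\<lambda>x. indicat_real {-pi..pi} x *\<^sub>R (cmod (h x))\<^sup>2)"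
      using int by (simp add: set_integrable_def)
    show "indicat_real {a..b} x *\<^sub>R (cmod (h x))\<^sup>2 \<le> indicat_real {-pi..pi} x *\<^sub>R (cmod (h x))\<^sup>2" for x
      using that by (auto split: split_indicator)
  qed
  from this[of "-pi" 0] this[of 0 pi]
  have "r1 * (LINT x:{-pi..0}|lborel. (cmod (h x))\<^sup>2) + r2 * (LINT x:{0..pi}|lborel. (cmod (h x))\<^sup>2)
      \<le> r1 * (LINT x:{-pi..pi}|lborel. (cmod (h x))\<^sup>2) + r2 * (LINT x:{-pi..pi}|lborel. (cmod (h x))\<^sup>2)"
    using r by (intro add_mono mult_left_mono) auto
  then show ?thesis unfolding normH_def ipH_self Re_complex_of_real by (simp add: distrib_right)
qed

lemma (in transmission) A0_dense:
  assumes f: "inH f" and "\<epsilon> > 0"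
  obtains y g where "A0 y g" "normH \<rho>12 \<rho>34 (\<lambda>x. f x - y x) < \<epsilon>"
proof -
  define R where "R = \<rho>12 + \<rho>34"
  have "R > 0" using rho12 rho34 by (simp add: R_def)
  then have "\<epsilon>\<^sup>2 / R > 0" using \<open>\<epsilon> > 0\<close> by simp
  then obtain y g where y: "A0 y g" "(LINT x:{-pi..pi}|lborel. (cmod (f x - y x))\<^sup>2) < \<epsilon>\<^sup>2 / R"
    using L2_approx_inH[OF f] unfolding L2_approx_def by blast
  have "normH \<rho>12 \<rho>34 (\<lambda>x. f x - y x) \<le> sqrt (R * (LINT x:{-pi..pi}|lborel. (cmod (f x - y x))\<^sup>2))"
    unfolding R_def using rho12 rho34 by (intro normH_le inH_diff f A0_inH[OF y(1)]) simp_all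
  also have "\<dots> < sqrt (\<epsilon>\<^sup>2)"
    using y(2) \<open>R > 0\<close> by (intro real_sqrt_less_mono) (simp add: field_simps)
  also have "\<dots> = \<epsilon>" using \<open>\<epsilon> > 0\<close> by simp
  finally show thesis using y(1) that by blast
qed

text \<open>Near the open end |q| is at most |L| + 1; what remains is a compact interval.\<close>

lemma continuous_on_bounded_if_limits:
  fixes q :: "real \<Rightarrow> real"
  shows "continuous_on {a..<b} q \<Longrightarrow> (q \<longlongrightarrow> L) (at_left b) \<Longrightarrow> \<exists>B. \<forall>x\<in>{a..<b}. \<bar>q x\<bar> \<le> B"
    and "continuous_on {a<..b} q \<Longrightarrow> (q \<longlongrightarrow> L) (at_right a) \<Longrightarrow> \<exists>B. \<forall>x\<in>{a<..b}. \<bar>q x\<bar> \<le> B"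
proof -
  have compact: "\<exists>B. \<forall>x\<in>{u..v}. \<bar>q x\<bar> \<le> B" if "continuous_on {u..v} q" for u v
    using compact_imp_bounded[OF compact_continuous_image[OF that compact_Icc]] by (auto simp: bounded_iff)
  have near: "eventually (\<lambda>x. \<bar>q x\<bar> \<le> \<bar>L\<bar> + 1) F" if "(q \<longlongrightarrow> L) F" for F
    using tendstoD[OF that zero_less_one] by eventually_elim (simp add: dist_real_def)
  show "\<exists>B. \<forall>x\<in>{a..<b}. \<bar>q x\<bar> \<le> B" if q: "continuous_on {a..<b} q" "(q \<longlongrightarrow> L) (at_left b)"
  proof -
    obtain c where c: "c < b" "\<And>x. c < x \<Longrightarrow> x < b \<Longrightarrow> \<bar>q x\<bar> \<le> \<bar>L\<bar> + 1"
      using near[OF q(2)] unfolding eventually_at_left_field by blast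
    have "{a..c} \<subseteq> {a..<b}" using c(1) by auto
    from compact[OF continuous_on_subset[OF q(1) this]] obtain B where "\<And>x. x \<in> {a..c} \<Longrightarrow> \<bar>q x\<bar> \<le> B" by blast
    then have "\<bar>q x\<bar> \<le> max B (\<bar>L\<bar> + 1)" if "x \<in> {a..<b}" for x
      using c(2)[of x] that by (cases "x \<le> c") (auto simp: le_max_iff_disj)
    then show ?thesis by blast
  qed
  show "\<exists>B. \<forall>x\<in>{a<..b}. \<bar>q x\<bar> \<le> B" if q: "continuous_on {a<..b} q" "(q \<longlongrightarrow> L) (at_right a)"
  proof -
    obtain c where c: "a < c" "\<And>x. a < x \<Longrightarrow> x < c \<Longrightarrow> \<bar>q x\<bar> \<le> \<bar>L\<bar> + 1"
      using near[OF q(2)] unfolding eventually_at_right_field by blast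
    have "{c..b} \<subseteq> {a<..b}" using c(1) by auto
    from compact[OF continuous_on_subset[OF q(1) this]] obtain B where "\<And>x. x \<in> {c..b} \<Longrightarrow> \<bar>q x\<bar> \<le> B" by blast
    then have "\<bar>q x\<bar> \<le> max B (\<bar>L\<bar> + 1)" if "x \<in> {a<..b}" for x
      using c(2)[of x] that by (cases "x < c") (auto simp: le_max_iff_disj)
    then show ?thesis by blast
  qed
qed

lemma inH_mult_potential:
  assumes q1: "continuous_on {-pi..<0} q" "(q \<longlongrightarrow> l1) (at_left 0)"
    and q2: "continuous_on {0<..pi} q" "(q \<longlongrightarrow> l2) (at_right 0)" and f: "inH f"
  shows "inH (\<lambda>x. of_real (q x) * f x)"
proof -
  obtain B1 where B1: "\<And>x. x \<in> {-pi..<0} \<Longrightarrow> \<bar>q x\<bar> \<le> B1" using continuous_on_bounded_if_limits(1)[OF q1] by blast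
  obtain B2 where B2: "\<And>x. x \<in> {0<..pi} \<Longrightarrow> \<bar>q x\<bar> \<le> B2" using continuous_on_bounded_if_limits(2)[OF q2] by blast
  have "(\<lambda>x. indicat_real {-pi..<0} x *\<^sub>R complex_of_real (q x)) \<in> borel_measurable borel"
    "(\<lambda>x. indicat_real {0<..pi} x *\<^sub>R complex_of_real (q x)) \<in> borel_measurable borel"
    by (rule borel_measurable_continuous_on_indicator, simp, intro continuous_intros q1 q2)+
  \<comment> \<open>\<open>q 0\<close> is subject to no condition, so the point 0 gets its own
    indicator term; the bound below contains |q 0| for the same reason.\<close>
  then have "(\<lambda>x. indicat_real {-pi..<0} x *\<^sub>R complex_of_real (q x) + indicat_real {0<..pi} x *\<^sub>R complex_of_real (q x)
      + indicat_real {0} x *\<^sub>R complex_of_real (q 0)) \<in> borel_measurable lborel" by simp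
  moreover have "indicat_real {-pi..<0} x *\<^sub>R complex_of_real (q x) + indicat_real {0<..pi} x *\<^sub>R complex_of_real (q x)
      + indicat_real {0} x *\<^sub>R complex_of_real (q 0) = indicat_real {-pi..pi} x *\<^sub>R complex_of_real (q x)" for x
    by (cases "x = 0") (auto split: split_indicator)
  ultimately have "set_borel_measurable lborel {-pi..pi} (\<lambda>x. complex_of_real (q x))"
    unfolding set_borel_measurable_def by simp
  moreover have "cmod (of_real (q x)) \<le> max (max B1 B2) \<bar>q 0\<bar>" if "x \<in> {-pi..pi}" for x
    using B1[of x] B2[of x] that by (cases x "0::real" rule: linorder_cases) (auto simp: le_max_iff_disj)
  ultimately show ?thesis
    using f unfolding inH_iff_L2 by (intro L2_mult_bounded)
qed

theorem theorem3:
  fixes q :: "real \<Rightarrow> real" and \<alpha> \<beta> a1 a2 a3 a4 b1 b2 b3 b4 :: real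
  assumes "continuous_on {-pi..<0} q" and "continuous_on {0<..pi} q"
    and "\<exists>L. (q \<longlongrightarrow> L) (at_left 0)" and "\<exists>L. (q \<longlongrightarrow> L) (at_right 0)"
    and "a1 * b2 - a2 * b1 > 0" and "a3 * b4 - a4 * b3 > 0"
  shows "self_adjointH (a1 * b2 - a2 * b1) (a3 * b4 - a4 * b3)
           (A_graph q \<alpha> \<beta> a1 a2 a3 a4 b1 b2 b3 b4)"
proof -
  interpret transmission \<alpha> \<beta> a1 a2 a3 a4 b1 b2 b3 b4 by unfold_locales fact+
  let ?A = "A_graph q \<alpha> \<beta> a1 a2 a3 a4 b1 b2 b3 b4"
  let ?ip = "ipH \<rho>12 \<rho>34"
  define Q where "Q f = (\<lambda>x. of_real (q x) * f x)" for f :: "real \<Rightarrow> complex"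
  have Q: "inH (Q f)" if "inH f" for f
    using assms(1-4) that inH_mult_potential unfolding Q_def by blast
  have ip_Q: "?ip (Q f) g = ?ip f (Q g)" for f g
    unfolding Q_def by (rule ipH_real_multiplier)
  have A_inH: "inH y" "inH g" if "?A y g" for y g
    using that by (simp_all add: A_graph_def)
  \<comment> \<open>The equation y'' = q y - g of the graph reads y'' = 0 * y - (g - q y).\<close>
  have A_A0: "A0 y (\<lambda>x. g x - Q y x)" if "?A y g" for y g
    using that inH_diff[OF A_inH(2)[OF that] Q[OF A_inH(1)[OF that]]] unfolding A_graph_def Q_def by simp
  have A0_A: "?A y (\<lambda>x. g x + Q y x)" if "A0 y g" for y g
  proof -
    have "inH y" "inH g" using that by (simp_all add: A_graph_def)
    \<comment> \<open>The sum g + Q y in the form of a difference, to which \<open>inH_diff\<close>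
      applies.\<close>
    then have "inH (\<lambda>x. g x - Q (\<lambda>x. - y x) x)"
      using inH_diff[OF _ Q] inH_diff[of "\<lambda>_. 0" y] L2_const[of "-pi" pi 0] by (simp add: inH_iff_L2)
    then show ?thesis using that unfolding A_graph_def Q_def by simp
  qed
  show ?thesis
    unfolding self_adjointH_def
  proof (intro conjI allI impI)
    fix y g assume "?A y g"
    then show "inH y" "inH g" by (rule A_inH)+
  next
    fix f and \<epsilon> :: real assume "inH f" "\<epsilon> > 0"
    then obtain y g where "A0 y g" "normH \<rho>12 \<rho>34 (\<lambda>x. f x - y x) < \<epsilon>" by (rule A0_dense)
    then show "\<exists>y g. ?A y g \<and> normH \<rho>12 \<rho>34 (\<lambda>x. f x - y x) < \<epsilon>" using A0_A by blast
  next
    fix z w assume "inH z \<and> inH w"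
    then have z: "inH z" and w: "inH w" by auto
    show "(\<forall>y g. ?A y g \<longrightarrow> ?ip g z = ?ip y w) \<longleftrightarrow> (\<exists>y g. ?A y g \<and> eqH y z \<and> eqH g w)"
    proof
      assume adj: "\<forall>y g. ?A y g \<longrightarrow> ?ip g z = ?ip y w"
      \<comment> \<open>Testing with the pair (y, g + Q y) of the full operator and moving Q to the
        other side turns the hypothesis into the adjoint identity of \<open>A0\<close> for z and w -
        Q z.\<close>
      have "?ip g z = ?ip y (\<lambda>x. w x - Q z x)" if y: "A0 y g" for y g
      proof -
        have H: "inH y" "inH g" using y by (simp_all add: A_graph_def)
        have "?ip g z = ?ip (\<lambda>x. (g x + Q y x) - Q y x) z" by simp
        also have "\<dots> = ?ip (\<lambda>x. g x + Q y x) z - ?ip (Q y) z"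
          by (rule ipH_diff_left[OF A_inH(2)[OF A0_A[OF y]] Q[OF H(1)] z])
        also have "\<dots> = ?ip y w - ?ip y (Q z)" using adj A0_A[OF y] ip_Q by simp
        also have "\<dots> = ?ip y (\<lambda>x. w x - Q z x)" by (rule ipH_diff_right[OF H(1) w Q[OF z], symmetric])
        finally show ?thesis .
      qed
      then obtain u where u: "A0 u (\<lambda>x. w x - Q z x)" "eqH u z"
        using A0_adjoint[OF z inH_diff[OF w Q[OF z]]] by blast
      \<comment> \<open>Applying the full operator to \<open>u\<close> gives back \<open>w\<close>
        up to a null set, because u = z almost everywhere.\<close>
      have "eqH (\<lambda>x. (w x - Q z x) + Q u x) w"
        using u(2) unfolding eqH_def by eventually_elim (simp add: Q_def)
      with A0_A[OF u(1)] u(2) show "\<exists>y g. ?A y g \<and> eqH y z \<and> eqH g w" by blast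
    next
      assume "\<exists>y g. ?A y g \<and> eqH y z \<and> eqH g w"
      then obtain y g where y: "?A y g" and eq: "eqH y z" "eqH g w" by blast
      note H = A_inH[OF y]
      show "\<forall>y g. ?A y g \<longrightarrow> ?ip g z = ?ip y w"
      proof (intro allI impI)
        fix v h assume v: "?A v h"
        note V = A_inH[OF v]
        have refl: "eqH f f" for f by (simp add: eqH_def)
        \<comment> \<open>Symmetry of \<open>A0\<close> for the reduced pairs; the two potential
          terms agree by \<open>ip_Q\<close> and drop out.\<close>
        have "?ip (\<lambda>x. h x - Q v x) y = ?ip v (\<lambda>x. g x - Q y x)"
          by (rule A0_symmetric[OF A_A0[OF v] A_A0[OF y]])
        then have "?ip h y = ?ip v g"
          unfolding ipH_diff_left[OF V(2) Q[OF V(1)] H(1)] ipH_diff_right[OF V(1) H(2) Q[OF H(1)]] ip_Q by simp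
        then show "?ip h z = ?ip v w"
          using ipH_cong[OF V(2) H(1) V(2) z refl eq(1)] ipH_cong[OF V(1) H(2) V(1) w refl eq(2)] by simp
      qed
    qed
  qed
qed

end
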